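(* Let $T$ be a tree, let $G\le\mathrm{Aut}(T)$, let $\Delta=\Delta(T,G)=(\Gamma,(X_a),(G(v)))$ be the associated local action diagram and let $\mathbf T$ be an associated $\Delta$-tree structure on $T$. Then $\mathbf U(\mathbf T,(G(v)))$ is the $(\mathrm{P})$-closure of $G$.
   Context: Graphs. A graph $\Gamma$ has a vertex set $V\Gamma$, an arc set $A\Gamma$, an origin map $o:A\Gamma\to V\Gamma$ and a reversal map $a\mapsto\overline a$ on $A\Gamma$ with $\overline{\overline a}=a$; $t(a):=o(\overline a)$. An arc with $o(a)=t(a)$ is a loop; for a loop both $\overline a=a$ and $\overline a\neq a$ are allowed. $o^{-1}(v)$ is the set of arcs with origin $v$. A tree is a nonempty connected graph without loops, multiple edges or cycles. Permutation groups carry the permutation topology (pointwise stabilisers of finite sets form a base of neighbourhoods of the identity), and $\mathrm{Aut}(T)\le\mathrm{Sym}(VT)$ the subspace topology. $G\backslash T$ is the graph of $G$-orbits on vertices and arcs. Property $(\mathrm{P})$ and $(\mathrm{P})$-closure. For $G\le\mathrm{Aut}(T)$ and a nonempty (finite or infinite) simple path $L$ in $T$, let $\pi_L:VT\to VL$ be the closest point projection and $G_{(L)}$ the pointwise stabiliser of $L$; for $x\in VL$ let $\phi_x:G_{(L)}\to\mathrm{Sym}(\pi_L^{-1}(x))$ be given by the action. $G$ has property $(\mathrm{P})$ if for every such $L$ the homomorphism $G_{(L)}\to\prod_{x\in VL}\phi_x(G_{(L)})$ is surjective. $G$ is $(\mathrm{P})$-closed if it is closed in $\mathrm{Aut}(T)$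 and has $(\mathrm{P})$. The $(\mathrm{P})$-closure of $G$ is the smallest $(\mathrm{P})$-closed subgroup of $\mathrm{Aut}(T)$ containing $G$; equivalently it is the set of $g\in\mathrm{Aut}(T)$ such that for every $v\in VT$ and every finite set $X$ of vertices at distance at most $1$ from $v$ there is $g_X\in G$ with $gw=g_Xw$ for all $w\in X$. Associated local action diagram and $\Delta$-tree. $\Gamma=G\backslash T$ with quotient map $\pi$. For each $v\in V\Gamma$ choose $v^*\in\pi^{-1}(v)$, and let $V^*$ be the set of chosen vertices. For $a\in o^{-1}(v)$, $X_a=\{b\in o^{-1}(v^* ):\pi(b)=a\}$; $X_v=o^{-1}(v^* )$; $G(v)$ is the closure in $\mathrm{Sym}(X_v)$ of the permutation group induced by $G_{v^*}$ on $X_v$. For each $w\in VT$ choose $g_w\in G$ with $g_ww\in V^*$, and for $b\in o^{-1}(w)$ set $\mathcal L(b)=g_wb$. The associated $\Delta$-tree structure on $T$ is $\mathbf T=(T,\mathcal L,\pi)$. Universal group. $\mathcal L$ restricts to a bijection $\mathcal L_v:o^{-1}(v)\to X_{\pi(v)}$ for each $v\in VT$. For $g\in\mathrm{Aut}(T)$ with $\pi\circ g=\pi$, $\sigma_{\mathcal L,v}(g)=\mathcal L_{gv}\circ g\circ\mathcal L_v^{-1}\in\mathrm{Sym}(X_{\pi(v)})$. $\mathbf U(\mathbf T,(G(v)))$ is the set of all $g\in\mathrm{Aut}(T)$ with $\pi\circ g=\pi$ and $\sigma_{\mathcal L,v}(g)\in G(\pi(v))$ for all $v\in VT$. *)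

theory Defs
  imports "HOL-Analysis.Abstract_Topology" "HOL-Algebra.Bij"
begin

section \<open>Graphs and trees\<close>

text \<open>Graphs with a reversal map on arcs. A loop may or may not be equal to its own reverse
  (self-reverse loops do occur in quotient graphs), so this is more general than a symmetric
  digraph with a fixed-point-free reversal.\<close>

record ('v, 'a) rgraph =
  verts :: "'v set"
  arcs :: "'a set"
  orig :: "'a \<Rightarrow> 'v"
  arev :: "'a \<Rightarrow> 'a"

definition term_of :: "('v, 'a) rgraph \<Rightarrow> 'a \<Rightarrow> 'v" where
  "term_of T a = orig T (arev T a)"

definition wf_rgraph :: "('v, 'a) rgraph \<Rightarrow> bool" where
  "wf_rgraph T \<longleftrightarrow>
     (\<forall>a\<in>arcs T. orig T a \<in> verts T \<and> arev T a \<in> arcs T \<and> arev T (arev T a) = a)"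

definition out_arcs :: "('v, 'a) rgraph \<Rightarrow> 'v \<Rightarrow> 'a set" where
  "out_arcs T v = {a \<in> arcs T. orig T a = v}"

definition adj :: "('v, 'a) rgraph \<Rightarrow> 'v \<Rightarrow> 'v \<Rightarrow> bool" where
  "adj T u v \<longleftrightarrow> (\<exists>a\<in>arcs T. orig T a = u \<and> term_of T a = v)"

definition walk :: "('v, 'a) rgraph \<Rightarrow> 'v list \<Rightarrow> bool" where
  "walk T xs \<longleftrightarrow> xs \<noteq> [] \<and> set xs \<subseteq> verts T \<and> successively (adj T) xs"

definition connected_rgraph :: "('v, 'a) rgraph \<Rightarrow> bool" where
  "connected_rgraph T \<longleftrightarrow>
     (\<forall>u\<in>verts T. \<forall>v\<in>verts T. \<exists>xs. walk T xs \<and> hd xs = u \<and> last xs = v)"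

text \<open>A cycle is given by its list of vertices, which determines it (up to the starting point)
  once loops and multiple edges are excluded.\<close>

definition is_cycle :: "('v, 'a) rgraph \<Rightarrow> 'v list \<Rightarrow> bool" where
  "is_cycle T xs \<longleftrightarrow> walk T xs \<and> distinct xs \<and> 3 \<le> length xs \<and> adj T (last xs) (hd xs)"

definition is_tree :: "('v, 'a) rgraph \<Rightarrow> bool" where
  "is_tree T \<longleftrightarrow>
     wf_rgraph T \<and> verts T \<noteq> {} \<and> connected_rgraph T \<and>
     (\<forall>a\<in>arcs T. orig T a \<noteq> term_of T a) \<and>
     inj_on (\<lambda>a. (orig T a, term_of T a)) (arcs T) \<and>
     (\<nexists>xs. is_cycle T xs)"

definition gdist :: "('v, 'a) rgraph \<Rightarrow> 'v \<Rightarrow> 'v \<Rightarrow> nat" where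
  "gdist T u v = (LEAST n. \<exists>xs. walk T xs \<and> hd xs = u \<and> last xs = v \<and> length xs = Suc n)"


section \<open>Automorphisms\<close>

text \<open>\<open>rgraph_aut_pair T g h\<close>: the vertex map \<open>g\<close> and the arc map \<open>h\<close> together form an
  automorphism of \<open>T\<close>. In a tree \<open>h\<close> is determined by \<open>g\<close>, which is what allows automorphisms to
  be regarded as permutations of the vertices; \<open>arc_act\<close> recovers \<open>h\<close>.\<close>

definition rgraph_aut_pair :: "('v, 'a) rgraph \<Rightarrow> ('v \<Rightarrow> 'v) \<Rightarrow> ('a \<Rightarrow> 'a) \<Rightarrow> bool" where
  "rgraph_aut_pair T g h \<longleftrightarrow>
     g \<in> Bij (verts T) \<and> h \<in> Bij (arcs T) \<and>
     (\<forall>a\<in>arcs T. orig T (h a) = g (orig T a) \<and> h (arev T a) = arev T (h a))"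

definition tree_aut :: "('v, 'a) rgraph \<Rightarrow> ('v \<Rightarrow> 'v) set" where
  "tree_aut T = {g. \<exists>h. rgraph_aut_pair T g h}"

definition arc_act :: "('v, 'a) rgraph \<Rightarrow> ('v \<Rightarrow> 'v) \<Rightarrow> 'a \<Rightarrow> 'a" where
  "arc_act T g = (THE h. rgraph_aut_pair T g h)"

definition AutT :: "('v, 'a) rgraph \<Rightarrow> ('v \<Rightarrow> 'v) monoid" where
  "AutT T = BijGroup (verts T) \<lparr>carrier := tree_aut T\<rparr>"


section \<open>The permutation topology\<close>

text \<open>The set of all \<open>h\<close> agreeing with \<open>g\<close> on the finite set \<open>F\<close> is the coset of the pointwise
  stabiliser of \<open>F\<close> containing \<open>g\<close>.\<close>

definition perm_topology :: "'x set \<Rightarrow> ('x \<Rightarrow> 'x) topology" where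
  "perm_topology X = topology (\<lambda>U. U \<subseteq> Bij X \<and>
     (\<forall>g\<in>U. \<exists>F. finite F \<and> F \<subseteq> X \<and> {h \<in> Bij X. \<forall>x\<in>F. h x = g x} \<subseteq> U))"

lemma openin_perm_topology:
  fixes X :: "'x set"
  shows "openin (perm_topology X) U \<longleftrightarrow> U \<subseteq> Bij X \<and>
     (\<forall>g\<in>U. \<exists>F. finite F \<and> F \<subseteq> X \<and> {h \<in> Bij X. \<forall>x\<in>F. h x = g x} \<subseteq> U)"
proof -
  define N where "N F g = {h \<in> Bij X. \<forall>x\<in>F. h x = g x}" for F and g :: "'x \<Rightarrow> 'x"
  have N_mono: "N (F \<union> F') g \<subseteq> N F g \<inter> N F' g" for F F' g
    by (auto simp: N_def)
  let ?P = "\<lambda>U. U \<subseteq> Bij X \<and> (\<forall>g\<in>U. \<exists>F. finite F \<and> F \<subseteq> X \<and> N F g \<subseteq> U)"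
  have "istopology ?P"
    unfolding istopology_def
  proof (intro conjI allI impI ballI)
    fix S S' assume S: "?P S" and S': "?P S'"
    show "S \<inter> S' \<subseteq> Bij X" using S by (simp add: le_infI1)
    fix g assume g: "g \<in> S \<inter> S'"
    obtain F where F: "finite F" "F \<subseteq> X" "N F g \<subseteq> S"
      using conjunct2[OF S] g by (meson IntD1)
    obtain F' where F': "finite F'" "F' \<subseteq> X" "N F' g \<subseteq> S'"
      using conjunct2[OF S'] g by (meson IntD2)
    have "finite (F \<union> F')" "F \<union> F' \<subseteq> X" using F F' by simp_all
    moreover have "N (F \<union> F') g \<subseteq> S \<inter> S'"
      using N_mono[of F F' g] F(3) F'(3) by blast
    ultimately show "\<exists>F. finite F \<and> F \<subseteq> X \<and> N F g \<subseteq> S \<inter> S'" by (intro exI conjI)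
  next
    fix \<K> assume K: "\<forall>K\<in>\<K>. ?P K"
    show "\<Union>\<K> \<subseteq> Bij X" using K by (simp add: Sup_least)
    fix g assume "g \<in> \<Union>\<K>"
    then obtain K where "K \<in> \<K>" "g \<in> K" by (rule UnionE)
    then obtain F where "finite F" "F \<subseteq> X" "N F g \<subseteq> K"
      using conjunct2[OF bspec[OF K \<open>K \<in> \<K>\<close>]] by (meson bspec)
    then show "\<exists>F. finite F \<and> F \<subseteq> X \<and> N F g \<subseteq> \<Union>\<K>"
      using \<open>K \<in> \<K>\<close> by (meson Union_upper order_trans)
  qed
  then show ?thesis
    unfolding perm_topology_def N_def by (simp only: topology_inverse')
qed

definition aut_topology :: "('v, 'a) rgraph \<Rightarrow> ('v \<Rightarrow> 'v) topology" where
  "aut_topology T = subtopology (perm_topology (verts T)) (tree_aut T)"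


section \<open>Property (P) and the (P)-closure\<close>

text \<open>A path is indexed by a nonempty set \<open>I\<close> of consecutive integers, so finite paths (including
  those of length zero), rays and bi-infinite lines are all covered.\<close>

definition simple_path :: "('v, 'a) rgraph \<Rightarrow> int set \<Rightarrow> (int \<Rightarrow> 'v) \<Rightarrow> bool" where
  "simple_path T I p \<longleftrightarrow>
     I \<noteq> {} \<and> (\<forall>i\<in>I. \<forall>k\<in>I. {i..k} \<subseteq> I) \<and>
     p ` I \<subseteq> verts T \<and> inj_on p I \<and>
     (\<forall>i. i \<in> I \<and> i + 1 \<in> I \<longrightarrow> adj T (p i) (p (i + 1)))"

text \<open>In a tree the closest vertex of a path is unique, so \<open>arg_min_on\<close> involves no real choice.\<close>

definition proj_path :: "('v, 'a) rgraph \<Rightarrow> 'v set \<Rightarrow> 'v \<Rightarrow> 'v" where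
  "proj_path T L v = arg_min_on (gdist T v) L"

definition fibre :: "('v, 'a) rgraph \<Rightarrow> 'v set \<Rightarrow> 'v \<Rightarrow> 'v set" where
  "fibre T L x = {v \<in> verts T. proj_path T L v = x}"

definition pointwise_stab :: "('v \<Rightarrow> 'v) set \<Rightarrow> 'v set \<Rightarrow> ('v \<Rightarrow> 'v) set" where
  "pointwise_stab G L = {g \<in> G. \<forall>x\<in>L. g x = x}"

text \<open>\<open>restrict g (fibre T L x)\<close> is \<open>\<phi>\<^sub>x(g)\<close>; the equation says that
  \<open>g \<mapsto> (\<phi>\<^sub>x(g))\<^sub>x\<close> maps the pointwise stabiliser of the path onto the full product of the groups
  \<open>\<phi>\<^sub>x(G\<^sub>(\<^sub>L\<^sub>))\<close>.\<close>

definition property_P :: "('v, 'a) rgraph \<Rightarrow> ('v \<Rightarrow> 'v) set \<Rightarrow> bool" where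
  "property_P T G \<longleftrightarrow> (\<forall>I p. simple_path T I p \<longrightarrow>
     (let L = p ` I; S = pointwise_stab G L in
        (\<lambda>g. \<lambda>x\<in>L. restrict g (fibre T L x)) ` S
          = (\<Pi>\<^sub>E x\<in>L. (\<lambda>g. restrict g (fibre T L x)) ` S)))"

definition P_closed :: "('v, 'a) rgraph \<Rightarrow> ('v \<Rightarrow> 'v) set \<Rightarrow> bool" where
  "P_closed T H \<longleftrightarrow> subgroup H (AutT T) \<and> closedin (aut_topology T) H \<and> property_P T H"

definition is_P_closure ::
  "('v, 'a) rgraph \<Rightarrow> ('v \<Rightarrow> 'v) set \<Rightarrow> ('v \<Rightarrow> 'v) set \<Rightarrow> bool" where
  "is_P_closure T G H \<longleftrightarrow>
     P_closed T H \<and> G \<subseteq> H \<and> (\<forall>K. P_closed T K \<and> G \<subseteq> K \<longrightarrow> H \<subseteq> K)"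


section \<open>The quotient graph and local action diagrams\<close>

definition vert_orbit :: "('v \<Rightarrow> 'v) set \<Rightarrow> 'v \<Rightarrow> 'v set" where
  "vert_orbit G v = {g v | g. g \<in> G}"

definition arc_orbit :: "('v, 'a) rgraph \<Rightarrow> ('v \<Rightarrow> 'v) set \<Rightarrow> 'a \<Rightarrow> 'a set" where
  "arc_orbit T G b = {arc_act T g b | g. g \<in> G}"

text \<open>The origins of the arcs in an orbit of arcs form an orbit of vertices, and their reverses form
  an orbit of arcs.\<close>

definition quotient_rgraph ::
  "('v, 'a) rgraph \<Rightarrow> ('v \<Rightarrow> 'v) set \<Rightarrow> ('v set, 'a set) rgraph" where
  "quotient_rgraph T G =
     \<lparr>verts = vert_orbit G ` verts T, arcs = arc_orbit T G ` arcs T,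
      orig = (\<lambda>A. orig T ` A), arev = (\<lambda>A. arev T ` A)\<rparr>"

record ('w, 'b, 'x) local_action_diagram =
  base :: "('w, 'b) rgraph"
  arc_colours :: "'b \<Rightarrow> 'x set"
  local_grp :: "'w \<Rightarrow> ('x \<Rightarrow> 'x) set"

definition vert_colours :: "('w, 'b, 'x) local_action_diagram \<Rightarrow> 'w \<Rightarrow> 'x set" where
  "vert_colours D v = (\<Union>a\<in>out_arcs (base D) v. arc_colours D a)"

text \<open>\<open>vs\<close> is the choice of representatives \<open>v \<mapsto> v\<^sup>*\<close>.\<close>

definition assoc_diagram ::
  "('v, 'a) rgraph \<Rightarrow> ('v \<Rightarrow> 'v) set \<Rightarrow> ('v set \<Rightarrow> 'v) \<Rightarrow>
     ('v set, 'a set, 'a) local_action_diagram" where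
  "assoc_diagram T G vs =
     (let Q = quotient_rgraph T G in
      \<lparr>base = Q,
       arc_colours = (\<lambda>a. {b \<in> out_arcs T (vs (orig Q a)). arc_orbit T G b = a}),
       local_grp = (\<lambda>v. let X = out_arcs T (vs v) in
         perm_topology X closure_of
           {restrict (arc_act T g) X | g. g \<in> pointwise_stab G {vs v}})\<rparr>)"

record ('v, 'a, 'w, 'b, 'x) delta_tree =
  dtree :: "('v, 'a) rgraph"
  label :: "'a \<Rightarrow> 'x"
  vproj :: "'v \<Rightarrow> 'w"
  aproj :: "'a \<Rightarrow> 'b"

text \<open>\<open>gw w\<close> is the chosen element of \<open>G\<close> moving \<open>w\<close> to the representative of its orbit.\<close>

definition assoc_delta_tree ::
  "('v, 'a) rgraph \<Rightarrow> ('v \<Rightarrow> 'v) set \<Rightarrow> ('v \<Rightarrow> 'v \<Rightarrow> 'v) \<Rightarrow>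
     ('v, 'a, 'v set, 'a set, 'a) delta_tree" where
  "assoc_delta_tree T G gw =
     \<lparr>dtree = T, label = (\<lambda>b. arc_act T (gw (orig T b)) b),
      vproj = vert_orbit G, aproj = arc_orbit T G\<rparr>"


section \<open>The universal group\<close>

definition local_action ::
  "('w, 'b, 'x) local_action_diagram \<Rightarrow> ('v, 'a, 'w, 'b, 'x) delta_tree \<Rightarrow>
     'v \<Rightarrow> ('v \<Rightarrow> 'v) \<Rightarrow> 'x \<Rightarrow> 'x" where
  "local_action D TT v g =
     (\<lambda>x\<in>vert_colours D (vproj TT v).
        label TT (arc_act (dtree TT) g (inv_into (out_arcs (dtree TT) v) (label TT) x)))"

definition universal_group ::
  "('w, 'b, 'x) local_action_diagram \<Rightarrow> ('v, 'a, 'w, 'b, 'x) delta_tree \<Rightarrow> ('v \<Rightarrow> 'v) set" where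
  "universal_group D TT =
     {g \<in> tree_aut (dtree TT).
        (\<forall>v\<in>verts (dtree TT). vproj TT (g v) = vproj TT v) \<and>
        (\<forall>a\<in>arcs (dtree TT). aproj TT (arc_act (dtree TT) g a) = aproj TT a) \<and>
        (\<forall>v\<in>verts (dtree TT). local_action D TT v g \<in> local_grp D (vproj TT v))}"

end

theory Submission
  imports Defs
begin

text \<open>Both the universal group and the \<open>(P)\<close>-closure are identified with the group \<open>C\<close> of all
  automorphisms that agree with elements of \<open>G\<close> on finite subsets of balls of radius \<open>1\<close>.
  Conjugating by the chosen elements \<open>gw v\<close> moves the local action of an automorphism at \<open>v\<close> to the
  representative of the orbit of \<open>v\<close>, where lying in the closure of the local group means exactly
  being matched by \<open>G\<close> on finite sets of arcs.

  The group \<open>C\<close> has property \<open>(P)\<close> because automorphisms fixing a path can be glued along the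
  fibres of the projection: on each ball of radius \<open>1\<close> the glued map agrees with one of them.
  Conversely, a closed group with property \<open>(P)\<close> that contains \<open>G\<close> contains every element of \<open>C\<close>,
  since property \<open>(P)\<close> for single edges amalgamates local agreement into agreement on arbitrary
  finite sets.\<close>

section \<open>Distances in trees\<close>

locale rtree =
  fixes T :: "('v, 'a) rgraph"
  assumes tree: "is_tree T"
begin

abbreviation V :: "'v set" where "V \<equiv> verts T"

abbreviation d :: "'v \<Rightarrow> 'v \<Rightarrow> nat" where "d \<equiv> gdist T"

lemma arc_verts:
  assumes "a \<in> arcs T"
  shows "orig T a \<in> V" "term_of T a \<in> V" "arev T a \<in> arcs T" "arev T (arev T a) = a"
    "orig T (arev T a) = term_of T a" "term_of T (arev T a) = orig T a"
  using tree assms unfolding is_tree_def wf_rgraph_def term_of_def by auto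

lemma arc_eqI:
  assumes "a \<in> arcs T" "b \<in> arcs T" "orig T a = orig T b" "term_of T a = term_of T b"
  shows "a = b"
  using tree assms unfolding is_tree_def inj_on_def by auto

lemma adj_verts: "adj T u v \<Longrightarrow> u \<in> V \<and> v \<in> V"
  unfolding adj_def using arc_verts by auto

lemma adj_sym: "adj T u v \<Longrightarrow> adj T v u"
  unfolding adj_def using arc_verts by metis

lemma adj_irrefl: "adj T u v \<Longrightarrow> u \<noteq> v"
  using tree unfolding adj_def is_tree_def by auto

lemma walk_snoc: "xs \<noteq> [] \<Longrightarrow> walk T (xs @ [x]) \<longleftrightarrow> walk T xs \<and> adj T (last xs) x"
  unfolding walk_def by (auto simp: successively_append_iff dest: adj_verts)

lemma walk_Cons: "xs \<noteq> [] \<Longrightarrow> walk T (x # xs) \<longleftrightarrow> walk T xs \<and> adj T x (hd xs)"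
  unfolding walk_def by (cases xs) (auto dest: adj_verts)

lemma walk_rev: "walk T xs \<Longrightarrow> walk T (rev xs)"
  unfolding walk_def by (auto elim!: successively_mono intro: adj_sym)

lemma gdist_le:
  "walk T xs \<Longrightarrow> hd xs = u \<Longrightarrow> last xs = v \<Longrightarrow> length xs = Suc n \<Longrightarrow> d u v \<le> n"
  unfolding gdist_def by (rule Least_le) blast

lemma gdist_walk:
  assumes "u \<in> V" "v \<in> V"
  obtains xs where "walk T xs" "hd xs = u" "last xs = v" "length xs = Suc (d u v)"
proof -
  obtain xs where xs: "walk T xs" "hd xs = u" "last xs = v"
    using tree assms unfolding is_tree_def connected_rgraph_def by blast
  moreover have "length xs = Suc (length xs - 1)" using xs by (cases xs) (auto simp: walk_def)
  ultimately have "\<exists>n xs. walk T xs \<and> hd xs = u \<and> last xs = v \<and> length xs = Suc n" by blast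
  then have "\<exists>xs. walk T xs \<and> hd xs = u \<and> last xs = v \<and> length xs = Suc (d u v)"
    unfolding gdist_def by (rule LeastI_ex)
  then show ?thesis using that by blast
qed

lemma gdist_self [simp]:
  assumes "u \<in> V" shows "d u u = 0"
  using gdist_le[of "[u]" u u 0] assms by (simp add: walk_def)

lemma gdist_eq_0:
  assumes "u \<in> V" "v \<in> V" "d u v = 0" shows "u = v"
proof -
  obtain xs where "hd xs = u" "last xs = v" "length xs = Suc 0"
    using gdist_walk[OF assms(1,2)] assms(3) by metis
  then show ?thesis by (cases xs) auto
qed

lemma gdist_sym_le:
  assumes "u \<in> V" "v \<in> V" shows "d u v \<le> d v u"
proof -
  obtain xs where "walk T xs" "hd xs = v" "last xs = u" "length xs = Suc (d v u)"
    using gdist_walk[OF assms(2,1)] by metis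
  then show ?thesis using gdist_le[of "rev xs"] walk_rev by (simp add: hd_rev last_rev)
qed

lemma gdist_commute: "u \<in> V \<Longrightarrow> v \<in> V \<Longrightarrow> d u v = d v u"
  by (simp add: gdist_sym_le order_antisym)

lemma gdist_step:
  assumes "u \<in> V" "adj T x y" shows "d u y \<le> Suc (d u x)"
proof -
  obtain xs where xs: "walk T xs" "hd xs = u" "last xs = x" "length xs = Suc (d u x)"
    using gdist_walk adj_verts assms by metis
  then have "xs \<noteq> []" by auto
  then show ?thesis using gdist_le[of "xs @ [y]"] xs assms by (simp add: walk_snoc)
qed

text \<open>The last but one vertex of a shortest walk from \<open>u\<close> to \<open>x\<close>
  serves as \<open>y\<close>.\<close>

lemma gdist_parent:
  assumes "u \<in> V" "x \<in> V" "d u x = Suc n"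
  obtains y where "adj T x y" "d u y = n"
proof -
  obtain xs where xs: "walk T xs" "hd xs = u" "last xs = x" "length xs = Suc (Suc n)"
    using gdist_walk assms by metis
  define ys where "ys = butlast xs"
  have ys: "xs = ys @ [x]" "length ys = Suc n" "ys \<noteq> []"
    using xs unfolding ys_def
    by (metis append_butlast_last_id length_0_conv nat.distinct(1), simp,
        metis diff_Suc_1 length_butlast length_0_conv nat.distinct(1))
  then have w: "walk T ys" "adj T (last ys) x" using xs by (simp_all add: walk_snoc)
  have "d u (last ys) \<le> n" using gdist_le[of ys] w ys xs by simp
  moreover have "Suc n \<le> Suc (d u (last ys))" using gdist_step[OF assms(1) w(2)] assms by simp
  ultimately show ?thesis using that[OF adj_sym[OF w(2)]] by simp
qed

section \<open>Acyclicity expressed through distances\<close>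

text \<open>Both vertices are replaced by neighbours closer to \<open>u\<close> until these
  coincide. The bound on the distances keeps the path simple: the new ends are farther from
  \<open>u\<close> than everything between them.\<close>

lemma equidistant_path:
  assumes "u \<in> V" "y \<in> V" "z \<in> V" "y \<noteq> z" "d u y = n" "d u z = n"
  shows "\<exists>xs. walk T xs \<and> distinct xs \<and> hd xs = y \<and> last xs = z \<and> 3 \<le> length xs \<and>
           (\<forall>x\<in>set xs. d u x \<le> n)"
  using assms(2-)
proof (induction n arbitrary: y z)
  case 0
  then show ?case using gdist_eq_0 assms(1) by metis
next
  case (Suc n)
  obtain y' where y': "adj T y y'" "d u y' = n" using gdist_parent assms(1) Suc.prems by metis
  obtain z' where z': "adj T z z'" "d u z' = n" using gdist_parent assms(1) Suc.prems by metis
  show ?case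
  proof (cases "y' = z'")
    case True
    have "walk T [y, y', z]"
      using y' z' True adj_verts[OF y'(1)] adj_verts[OF z'(1)] adj_sym by (simp add: walk_def)
    then show ?thesis using Suc.prems y' z' by (intro exI[of _ "[y, y', z]"]) auto
  next
    case False
    obtain xs where xs: "walk T xs" "distinct xs" "hd xs = y'" "last xs = z'" "3 \<le> length xs"
      "\<forall>x\<in>set xs. d u x \<le> n"
      using Suc.IH[of y' z'] False y' z' adj_verts by blast
    then have "xs \<noteq> []" by auto
    then have "walk T (y # xs @ [z])"
      using xs y' z' by (simp add: walk_Cons walk_snoc adj_sym)
    moreover have "y \<notin> set xs" "z \<notin> set xs" using xs Suc.prems by fastforce+
    ultimately show ?thesis using Suc.prems xs by (intro exI[of _ "y # xs @ [z]"]) auto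
  qed
qed

text \<open>An edge with equidistant ends would close the path of \<open>equidistant_path\<close> to
  a cycle.\<close>

lemma gdist_adj_neq:
  assumes "u \<in> V" "adj T x y" shows "d u x \<noteq> d u y"
proof
  assume "d u x = d u y"
  then obtain xs where "walk T xs" "distinct xs" "hd xs = x" "last xs = y" "3 \<le> length xs"
    using equidistant_path[OF assms(1), of x y] adj_verts adj_irrefl assms(2) by metis
  then have "is_cycle T xs" using assms(2) adj_sym by (simp add: is_cycle_def)
  then show False using tree by (auto simp: is_tree_def)
qed

lemma gdist_adj_cases:
  assumes "u \<in> V" "adj T x y"
  shows "d u x = Suc (d u y) \<or> d u y = Suc (d u x)"
  using gdist_step[OF assms] gdist_step[OF assms(1) adj_sym[OF assms(2)]] gdist_adj_neq[OF assms]
  by linarith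

text \<open>Two distinct candidates would be joined by a path whose vertices are all closer to
  \<open>u\<close> than \<open>x\<close>; adding \<open>x\<close> closes it to a cycle.\<close>

lemma gdist_parent_unique:
  assumes "u \<in> V" "adj T x y" "adj T x z" "d u y < d u x" "d u z < d u x"
  shows "y = z"
proof (rule ccontr)
  assume "y \<noteq> z"
  have n: "d u x = Suc (d u y)" "d u z = d u y"
    using gdist_adj_cases[OF assms(1,2)] gdist_adj_cases[OF assms(1,3)] assms(4,5) by auto
  then obtain xs where xs: "walk T xs" "distinct xs" "hd xs = y" "last xs = z" "3 \<le> length xs"
    "\<forall>w\<in>set xs. d u w \<le> d u y"
    using equidistant_path[OF assms(1), of y z] adj_verts assms \<open>y \<noteq> z\<close> by metis
  moreover have "x \<notin> set xs" using xs n by fastforce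
  moreover have "xs \<noteq> []" using xs by auto
  ultimately have "is_cycle T (x # xs)"
    using assms adj_sym by (simp add: is_cycle_def walk_Cons)
  then show False using tree by (auto simp: is_tree_def)
qed

text \<open>The half-trees of the edge \<open>xy\<close> are \<open>{v. d v x < d v y}\<close> and \<open>{v. d v y < d v x}\<close>.\<close>

lemma edge_separates:
  assumes "adj T x y" "adj T v w" "d v x < d v y" "d w y < d w x"
  shows "v = x \<and> w = y"
proof -
  have V: "x \<in> V" "y \<in> V" "v \<in> V" "w \<in> V" using adj_verts assms by auto
  have 1: "d v y = Suc (d v x)" "d w x = Suc (d w y)"
    using gdist_adj_cases[OF V(3) assms(1)] gdist_adj_cases[OF V(4) assms(1)] assms(3,4) by auto
  have x: "d v x = Suc (d w x) \<or> d w x = Suc (d v x)"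
    using gdist_adj_cases[OF V(1) assms(2)] V by (simp add: gdist_commute)
  have y: "d v y = Suc (d w y) \<or> d w y = Suc (d v y)"
    using gdist_adj_cases[OF V(2) assms(2)] V by (simp add: gdist_commute)
  \<comment> \<open>Along the edge from \<open>v\<close> to \<open>w\<close> the distances to
    \<open>x\<close> and to \<open>y\<close> change by exactly one; of the four cases only equality
    survives.\<close>
  have eq: "d w y = d v x" using 1 x y by linarith
  show ?thesis
  proof (cases "d v x")
    case 0
    then show ?thesis using eq gdist_eq_0 V by metis
  next
    case (Suc n)
    \<comment> \<open>Both \<open>z\<close> and \<open>x\<close> are neighbours of \<open>y\<close>
      closer to \<open>v\<close>, so they coincide; yet from \<open>w\<close> the first is nearer
      than \<open>y\<close> and the second farther.\<close>
    obtain z where z: "adj T y z" "d w z = n" using gdist_parent[OF V(4,2)] eq Suc by metis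
    have "d v z \<le> Suc n"
      using gdist_step[of z w v] z adj_verts[OF z(1)] V adj_sym[OF assms(2)]
      by (simp add: gdist_commute)
    then have "z = x"
      using gdist_parent_unique[OF V(3) z(1) adj_sym[OF assms(1)]] 1 Suc by simp
    then show ?thesis using z 1 eq Suc by simp
  qed
qed

section \<open>Projection to a path\<close>

text \<open>After a step away from \<open>v\<close>, the only neighbour closer to \<open>v\<close>
  is the previous vertex of the path. By injectivity the next vertex is a different one, hence
  farther.\<close>

lemma path_dist_increasing:
  assumes p: "simple_path T I p" and v: "v \<in> V" and i: "i \<in> I"
    and start: "i + 1 \<in> I \<Longrightarrow> d v (p i) < d v (p (i + 1))"
  shows "i + int (Suc k) \<in> I \<Longrightarrow> d v (p (i + int k)) < d v (p (i + int (Suc k)))"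
proof (induction k)
  case 0
  then show ?case using start by simp
next
  case (Suc k)
  define j where "j = i + int (Suc k)"
  have "{i..i + int (Suc (Suc k))} \<subseteq> I" using p i Suc.prems unfolding simple_path_def by blast
  then have I: "j - 1 \<in> I" "j \<in> I" "j + 1 \<in> I" unfolding j_def by auto
  have less: "d v (p (j - 1)) < d v (p j)" using Suc.IH I unfolding j_def by (simp add: algebra_simps)
  have "j - 1 \<in> I \<and> j - 1 + 1 \<in> I" "j \<in> I \<and> j + 1 \<in> I" using I by auto
  then have "adj T (p (j - 1)) (p (j - 1 + 1))" and adj: "adj T (p j) (p (j + 1))"
    using p unfolding simple_path_def by blast+
  then have adj': "adj T (p j) (p (j - 1))" using adj_sym by simp
  have "p (j - 1) \<noteq> p (j + 1)"
    using p I unfolding simple_path_def inj_on_def by force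
  then have "\<not> d v (p (j + 1)) < d v (p j)"
    using gdist_parent_unique[OF v adj adj'] less by auto
  then have "d v (p j) < d v (p (j + 1))" using gdist_adj_neq[OF v adj] by linarith
  then show ?case unfolding j_def by (simp add: algebra_simps)
qed

lemma path_right_min:
  assumes p: "simple_path T I p" and v: "v \<in> V" and i: "i \<in> I"
    and start: "i + 1 \<in> I \<Longrightarrow> d v (p i) < d v (p (i + 1))"
    and j: "j \<in> I" "i < j"
  shows "d v (p i) < d v (p j)"
proof -
  have step: "i + int (Suc k) \<in> I \<Longrightarrow> d v (p i) < d v (p (i + int (Suc k)))" for k
  proof (induction k)
    case 0
    then show ?case using start by simp
  next
    case (Suc k)
    have "{i..i + int (Suc (Suc k))} \<subseteq> I" using p i Suc.prems unfolding simple_path_def by blast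
    then have "i + int (Suc k) \<in> I" by auto
    then show ?case
      using Suc path_dist_increasing[OF p v i start, of "Suc k"] by (meson less_trans)
  qed
  have "j = i + int (Suc (nat (j - i - 1)))" using j by simp
  then show ?thesis using step j by metis
qed

text \<open>Negating the indices lets \<open>path_right_min\<close> cover the vertices to the left
  of an index as well.\<close>

lemma simple_path_reverse:
  assumes "simple_path T I p"
  shows "simple_path T (uminus ` I) (\<lambda>i. p (- i))"
proof -
  have p: "I \<noteq> {}" "\<And>i k. i \<in> I \<Longrightarrow> k \<in> I \<Longrightarrow> {i..k} \<subseteq> I" "p ` I \<subseteq> V" "inj_on p I"
    "\<And>i. i \<in> I \<Longrightarrow> i + 1 \<in> I \<Longrightarrow> adj T (p i) (p (i + 1))"
    using assms unfolding simple_path_def by blast+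
  have m: "i \<in> uminus ` I \<longleftrightarrow> - i \<in> I" for i :: int by force
  show ?thesis
    unfolding simple_path_def
  proof (intro conjI allI ballI impI)
    fix i k assume "i \<in> uminus ` I" "k \<in> uminus ` I"
    then have "{- k..- i} \<subseteq> I" using p(2) m by blast
    then have "- x \<in> I" if "x \<in> {i..k}" for x using that by (auto dest: subsetD)
    then show "{i..k} \<subseteq> uminus ` I" by (force simp: m)
  next
    fix i assume "i \<in> uminus ` I \<and> i + 1 \<in> uminus ` I"
    then have "- (i + 1) \<in> I" "- (i + 1) + 1 \<in> I" unfolding m by simp_all
    from p(5)[OF this] show "adj T (p (- i)) (p (- (i + 1)))" by (simp add: adj_sym)
  next
    show "inj_on (\<lambda>i. p (- i)) (uminus ` I)" using p(4) by (auto simp: inj_on_def)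
  qed (use p in auto)
qed

text \<open>Along a path the distance to a fixed vertex is V-shaped, so a local minimum is the strict
  global minimum.\<close>

lemma path_local_min:
  assumes p: "simple_path T I p" and v: "v \<in> V" and i: "i \<in> I"
    and local: "\<And>k. k \<in> I \<Longrightarrow> k = i + 1 \<or> k = i - 1 \<Longrightarrow> d v (p i) < d v (p k)"
    and j: "j \<in> I" "j \<noteq> i"
  shows "d v (p i) < d v (p j)"
proof (cases "i < j")
  case True
  then show ?thesis using path_right_min[OF p v i _ j(1)] local by blast
next
  case False
  have m: "k \<in> uminus ` I \<longleftrightarrow> - k \<in> I" for k :: int by force
  have "d v (p (- (- i))) < d v (p (- (- j)))"
    by (rule path_right_min[OF simple_path_reverse[OF p] v])
       (use i j False local[of "i - 1"] m in auto)
  then show ?thesis by simp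
qed

text \<open>\<open>arg_min_on\<close> is a Hilbert choice among minimisers, and a strict minimiser
  is the only one.\<close>

lemma proj_path_eqI:
  assumes "x \<in> L" "\<And>y. y \<in> L \<Longrightarrow> y \<noteq> x \<Longrightarrow> d v x < d v y"
  shows "proj_path T L v = x"
  unfolding proj_path_def arg_min_on_def arg_min_def
  using assms by (intro some_equality) (auto simp: is_arg_min_def dest: less_asym)

text \<open>Distances are natural numbers, so the minimum is attained, also on an infinite
  path.\<close>

lemma proj_path_le:
  assumes "L \<noteq> {}"
  shows "proj_path T L v \<in> L" "y \<in> L \<Longrightarrow> d v (proj_path T L v) \<le> d v y"
proof -
  obtain x where "x \<in> L" using assms by auto
  then have "is_arg_min (d v) (\<lambda>x. x \<in> L) (proj_path T L v)"
    unfolding proj_path_def arg_min_on_def using arg_min_natI[of "\<lambda>x. x \<in> L" x "d v"]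
    by (metis arg_min_nat_le is_arg_min_linorder)
  then show "proj_path T L v \<in> L" "y \<in> L \<Longrightarrow> d v (proj_path T L v) \<le> d v y"
    by (auto simp: is_arg_min_linorder)
qed

lemma proj_path_self:
  assumes "x \<in> L" "L \<subseteq> V" shows "proj_path T L x = x"
proof (rule proj_path_eqI)
  fix y assume "y \<in> L" "y \<noteq> x"
  then have "d x y \<noteq> 0" using assms gdist_eq_0[of x y] by blast
  then show "d x x < d x y" using assms by auto
qed (fact assms)

lemma simple_path_subset: "simple_path T I p \<Longrightarrow> p ` I \<subseteq> V \<and> p ` I \<noteq> {}"
  unfolding simple_path_def by auto

text \<open>Let \<open>p i\<close> be the projection of \<open>v\<close>. If it were not a local
  minimum for \<open>w\<close> too, an edge of the path at \<open>p i\<close> would have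
  \<open>v\<close> and \<open>w\<close> on different sides, and \<open>edge_separates\<close> would
  put \<open>v\<close> on the path.\<close>

lemma proj_path_adj:
  assumes p: "simple_path T I p" and adj: "adj T v w" and notin: "v \<notin> p ` I"
  shows "proj_path T (p ` I) w = proj_path T (p ` I) v"
proof -
  note V = adj_verts[OF adj]
  have ne: "p ` I \<noteq> {}" using p simple_path_subset by blast
  obtain i where i: "i \<in> I" "proj_path T (p ` I) v = p i" using proj_path_le(1)[OF ne] by blast
  have local: "d w (p i) < d w (p k)" if k: "k \<in> I" "k = i + 1 \<or> k = i - 1" for k
  proof (rule ccontr)
    have "adj T (p i) (p k)"
    proof (cases "k = i + 1")
      case True
      then show ?thesis using p i k unfolding simple_path_def by blast
    next
      case False
      then have "k \<in> I \<and> k + 1 \<in> I" "i = k + 1" using i k by auto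
      then show ?thesis using p adj_sym unfolding simple_path_def by blast
    qed
    moreover have "d v (p i) \<le> d v (p k)" using proj_path_le(2)[OF ne, of "p k" v] i k by simp
    moreover assume "\<not> d w (p i) < d w (p k)"
    \<comment> \<open>Distances to the two ends of an edge differ, so the weak inequalities for
      \<open>v\<close> and \<open>w\<close> are strict.\<close>
    ultimately have "v = p i"
      using edge_separates[of "p i" "p k" v w] adj V gdist_adj_neq by (metis nat_less_le not_less)
    then show False using notin i by blast
  qed
  have "proj_path T (p ` I) w = p i"
    by (rule proj_path_eqI) (use i path_local_min[OF p conjunct2[OF V] i(1) local] in auto)
  then show ?thesis using i by simp
qed

section \<open>Automorphisms\<close>

lemma tree_aut_Bij: "g \<in> tree_aut T \<Longrightarrow> g \<in> Bij V"
  unfolding tree_aut_def rgraph_aut_pair_def by auto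

lemma tree_aut_pairD:
  assumes "rgraph_aut_pair T g h" "a \<in> arcs T"
  shows "h a \<in> arcs T" "orig T (h a) = g (orig T a)" "term_of T (h a) = g (term_of T a)"
proof -
  show "h a \<in> arcs T" "orig T (h a) = g (orig T a)"
    using assms unfolding rgraph_aut_pair_def Bij_def bij_betw_def by auto
  have "orig T (h (arev T a)) = g (orig T (arev T a))"
    using assms(1) arc_verts(3)[OF assms(2)] unfolding rgraph_aut_pair_def by blast
  moreover have "h (arev T a) = arev T (h a)"
    using assms unfolding rgraph_aut_pair_def by blast
  ultimately
  show "term_of T (h a) = g (term_of T a)" by (simp add: term_of_def)
qed

text \<open>Arcs of a tree are determined by their ends, and both arc maps are extensional.\<close>

lemma rgraph_aut_pair_unique:
  assumes "rgraph_aut_pair T g h" "rgraph_aut_pair T g h'"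
  shows "h = h'"
proof (rule extensionalityI)
  show "h \<in> extensional (arcs T)" "h' \<in> extensional (arcs T)"
    using assms unfolding rgraph_aut_pair_def Bij_def by auto
  show "h a = h' a" if "a \<in> arcs T" for a
    using tree_aut_pairD[OF assms(1) that] tree_aut_pairD[OF assms(2) that] by (simp add: arc_eqI)
qed

lemma arc_act_pair:
  assumes "g \<in> tree_aut T" shows "rgraph_aut_pair T g (arc_act T g)"
proof -
  obtain h where h: "rgraph_aut_pair T g h" using assms unfolding tree_aut_def by auto
  then show ?thesis
    unfolding arc_act_def
    by (rule theI[where P = "rgraph_aut_pair T g"]) (rule rgraph_aut_pair_unique[OF _ h])
qed

lemma arc_act:
  assumes "g \<in> tree_aut T" "a \<in> arcs T"
  shows "arc_act T g a \<in> arcs T" "orig T (arc_act T g a) = g (orig T a)"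
    "term_of T (arc_act T g a) = g (term_of T a)"
  using tree_aut_pairD[OF arc_act_pair[OF assms(1)] assms(2)] by auto

lemma tree_aut_mem: "g \<in> tree_aut T \<Longrightarrow> v \<in> V \<Longrightarrow> g v \<in> V"
  using tree_aut_Bij unfolding Bij_def bij_betw_def by auto

lemma tree_aut_adj: "g \<in> tree_aut T \<Longrightarrow> adj T u v \<Longrightarrow> adj T (g u) (g v)"
  unfolding adj_def using arc_act by metis

text \<open>The restriction makes the inverse extensional, so that it is again an element of
  \<open>Bij V\<close>.\<close>

definition tinv :: "('v \<Rightarrow> 'v) \<Rightarrow> 'v \<Rightarrow> 'v" where
  "tinv g = (\<lambda>v\<in>V. inv_into V g v)"

lemma Bij_tinv: "g \<in> Bij V \<Longrightarrow> tinv g \<in> Bij V"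
  unfolding tinv_def by (rule restrict_inv_into_Bij)

lemma tinv_left: "g \<in> Bij V \<Longrightarrow> v \<in> V \<Longrightarrow> tinv g (g v) = v"
  unfolding tinv_def Bij_def bij_betw_def by auto

lemma tinv_right: "g \<in> Bij V \<Longrightarrow> v \<in> V \<Longrightarrow> g (tinv g v) = v"
  unfolding tinv_def Bij_def bij_betw_def by (auto simp: f_inv_into_f)

lemma tree_aut_pair_arcs:
  assumes g: "g \<in> Bij V" and adj: "\<And>u v. adj T u v \<Longrightarrow> adj T (g u) (g v)"
  obtains h where "\<And>a. a \<in> arcs T \<Longrightarrow>
    h a \<in> arcs T \<and> orig T (h a) = g (orig T a) \<and> term_of T (h a) = g (term_of T a)"
proof -
  have "\<forall>a\<in>arcs T. \<exists>b. b \<in> arcs T \<and> orig T b = g (orig T a) \<and> term_of T b = g (term_of T a)"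
    using adj unfolding adj_def by metis
  then show ?thesis using that by (metis bchoice)
qed

text \<open>The arc map is constructed: arcs are lifted along \<open>g\<close> and along its
  inverse, and the two lifts are mutually inverse because arcs are determined by their ends.\<close>

lemma tree_autI:
  assumes g: "g \<in> Bij V" and adj: "\<And>u v. adj T u v \<Longrightarrow> adj T (g u) (g v)"
    and inv_adj: "\<And>u v. adj T u v \<Longrightarrow> adj T (tinv g u) (tinv g v)"
  shows "g \<in> tree_aut T"
proof -
  obtain h where h: "\<And>a. a \<in> arcs T \<Longrightarrow>
      h a \<in> arcs T \<and> orig T (h a) = g (orig T a) \<and> term_of T (h a) = g (term_of T a)"
    using tree_aut_pair_arcs[OF g adj] by blast
  obtain k where k: "\<And>a. a \<in> arcs T \<Longrightarrow>
      k a \<in> arcs T \<and> orig T (k a) = tinv g (orig T a) \<and> term_of T (k a) = tinv g (term_of T a)"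
    using tree_aut_pair_arcs[OF Bij_tinv[OF g] inv_adj] by blast
  have kh: "k (h a) = a" "h (k a) = a" if a: "a \<in> arcs T" for a
    using a h k tinv_left[OF g] tinv_right[OF g] arc_verts(1,2)[OF a] by (auto intro!: arc_eqI)
  have rev: "h (arev T a) = arev T (h a)" if a: "a \<in> arcs T" for a
    using h[OF a] h[OF arc_verts(3)[OF a]] arc_verts[OF a] arc_verts[of "h a"]
    by (intro arc_eqI) auto
  have "bij_betw h (arcs T) (arcs T)"
    by (rule bij_betw_byWitness[where f' = k]) (use h k kh in auto)
  then have "rgraph_aut_pair T g (restrict h (arcs T))"
    unfolding rgraph_aut_pair_def Bij_def
    using g h rev arc_verts by (auto simp: Bij_def)
  then show ?thesis unfolding tree_aut_def by blast
qed

lemma tree_aut_tinv: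
  assumes "g \<in> tree_aut T" shows "tinv g \<in> tree_aut T"
proof (rule tree_autI)
  note g = tree_aut_Bij[OF assms]
  show "tinv g \<in> Bij V" using g by (rule Bij_tinv)
  show adj: "adj T (tinv g u) (tinv g v)" if "adj T u v" for u v
  proof -
    obtain a where a: "a \<in> arcs T" "orig T a = u" "term_of T a = v"
      using \<open>adj T u v\<close> unfolding adj_def by auto
    \<comment> \<open>The arc map is onto, so each edge is the image of an edge, whose ends are the
      inverse images.\<close>
    have "arc_act T g ` arcs T = arcs T"
      using arc_act_pair[OF assms] unfolding rgraph_aut_pair_def Bij_def bij_betw_def by auto
    then obtain b where b: "b \<in> arcs T" "a = arc_act T g b" using a by blast
    then have "tinv g u = orig T b" "tinv g v = term_of T b"
      using a arc_act[OF assms b(1)] arc_verts[OF b(1)] tinv_left[OF g] by auto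
    then show ?thesis using b unfolding adj_def by auto
  qed
  show "adj T (tinv (tinv g) u) (tinv (tinv g) v)" if uv: "adj T u v" for u v
  proof -
    have "tinv (tinv g) w = g w" if w: "w \<in> V" for w
      using tinv_left[OF Bij_tinv[OF g], of "g w"] tinv_left[OF g w] tree_aut_mem[OF assms w] by simp
    then show ?thesis using uv adj_verts[OF uv] tree_aut_adj[OF assms uv] by simp
  qed
qed

lemma tree_aut_compose:
  assumes "g \<in> tree_aut T" "h \<in> tree_aut T" shows "compose V g h \<in> tree_aut T"
proof (rule tree_autI)
  note B = assms[THEN tree_aut_Bij]
  show B': "compose V g h \<in> Bij V" using B by (rule compose_Bij)
  show "adj T (compose V g h u) (compose V g h v)" if "adj T u v" for u v
    using that assms adj_verts[OF that] by (simp add: compose_eq tree_aut_adj)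
  show "adj T (tinv (compose V g h) u) (tinv (compose V g h) v)" if uv: "adj T u v" for u v
  proof -
    have "tinv (compose V g h) w = tinv h (tinv g w)" if w: "w \<in> V" for w
    proof -
      have m: "tinv g w \<in> V" "tinv h (tinv g w) \<in> V"
        using w assms tree_aut_tinv tree_aut_mem by blast+
      then have "compose V g h (tinv h (tinv g w)) = w"
        using w B by (simp add: compose_eq tinv_right)
      then show ?thesis using tinv_left[OF B' m(2)] by simp
    qed
    then show ?thesis using uv adj_verts[OF uv] assms by (simp add: tree_aut_adj tree_aut_tinv)
  qed
qed

lemma tree_aut_id: "(\<lambda>v\<in>V. v) \<in> tree_aut T"
proof (rule tree_autI)
  show B: "(\<lambda>v\<in>V. v) \<in> Bij V" by (rule id_Bij)
  show "adj T ((\<lambda>v\<in>V. v) u) ((\<lambda>v\<in>V. v) v)" if "adj T u v" for u v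
    using that adj_verts by simp
  have "tinv (\<lambda>v\<in>V. v) w = w" if "w \<in> V" for w
    using tinv_left[OF B that] that by simp
  then show "adj T (tinv (\<lambda>v\<in>V. v) u) (tinv (\<lambda>v\<in>V. v) v)" if "adj T u v" for u v
    using that adj_verts by simp
qed

section \<open>The automorphism group and its subgroups\<close>

lemma AutT_mult: "g \<in> tree_aut T \<Longrightarrow> h \<in> tree_aut T \<Longrightarrow> g \<otimes>\<^bsub>AutT T\<^esub> h = compose V g h"
  by (simp add: AutT_def BijGroup_def tree_aut_Bij)

lemma AutT_one: "\<one>\<^bsub>AutT T\<^esub> = (\<lambda>v\<in>V. v)"
  by (simp add: AutT_def BijGroup_def)

lemma AutT_carrier: "carrier (AutT T) = tree_aut T"
  by (simp add: AutT_def)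

lemma tinv_compose: "g \<in> Bij V \<Longrightarrow> compose V (tinv g) g = (\<lambda>v\<in>V. v)"
  by (auto simp: compose_def tinv_left)

text \<open>\<open>AutT\<close> changes the carrier of \<open>BijGroup\<close>, so the group laws
  are established anew; they make it possible to compute the inverse as \<open>tinv\<close>.\<close>

lemma group_AutT: "group (AutT T)"
proof (rule groupI)
  show "\<exists>h\<in>carrier (AutT T). h \<otimes>\<^bsub>AutT T\<^esub> g = \<one>\<^bsub>AutT T\<^esub>" if "g \<in> carrier (AutT T)" for g
    using that by (intro bexI[of _ "tinv g"])
      (simp_all add: AutT_carrier AutT_mult AutT_one tree_aut_tinv tinv_compose tree_aut_Bij)
  show "\<one>\<^bsub>AutT T\<^esub> \<otimes>\<^bsub>AutT T\<^esub> g = g" if "g \<in> carrier (AutT T)" for g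
  proof -
    have g: "g \<in> tree_aut T" using that by (simp add: AutT_carrier)
    have "compose V (\<lambda>v\<in>V. v) g = g"
      by (rule Id_compose) (use tree_aut_Bij[OF g] in \<open>auto simp: Bij_def bij_betw_def\<close>)
    then show ?thesis using g by (simp add: AutT_mult AutT_one tree_aut_id)
  qed
  show "f \<otimes>\<^bsub>AutT T\<^esub> g \<otimes>\<^bsub>AutT T\<^esub> h = f \<otimes>\<^bsub>AutT T\<^esub> (g \<otimes>\<^bsub>AutT T\<^esub> h)"
    if "f \<in> carrier (AutT T)" "g \<in> carrier (AutT T)" "h \<in> carrier (AutT T)" for f g h
    using that
    by (simp add: AutT_carrier AutT_mult tree_aut_compose)
       (rule compose_assoc[symmetric], auto simp: tree_aut_mem)
qed (simp_all add: AutT_carrier AutT_mult AutT_one tree_aut_compose tree_aut_id)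

lemma AutT_inv:
  assumes "g \<in> tree_aut T" shows "inv\<^bsub>AutT T\<^esub> g = tinv g"
proof -
  have "tinv g \<otimes>\<^bsub>AutT T\<^esub> g = \<one>\<^bsub>AutT T\<^esub>"
    using assms by (simp add: AutT_mult AutT_one tree_aut_tinv tinv_compose tree_aut_Bij)
  then show ?thesis
    using group.inv_equality[OF group_AutT] assms by (simp add: AutT_carrier tree_aut_tinv)
qed

lemma subgroup_AutT_iff:
  "subgroup H (AutT T) \<longleftrightarrow> H \<subseteq> tree_aut T \<and> (\<lambda>v\<in>V. v) \<in> H \<and>
     (\<forall>g\<in>H. \<forall>h\<in>H. compose V g h \<in> H) \<and> (\<forall>g\<in>H. tinv g \<in> H)"
proof
  assume H: "subgroup H (AutT T)"
  then have sub: "H \<subseteq> tree_aut T" using subgroup.subset AutT_carrier by metis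
  show "H \<subseteq> tree_aut T \<and> (\<lambda>v\<in>V. v) \<in> H \<and>
     (\<forall>g\<in>H. \<forall>h\<in>H. compose V g h \<in> H) \<and> (\<forall>g\<in>H. tinv g \<in> H)"
    using sub subgroup.one_closed[OF H] subgroup.m_closed[OF H] subgroup.m_inv_closed[OF H]
    by (metis AutT_one AutT_mult AutT_inv subsetD)
next
  assume H: "H \<subseteq> tree_aut T \<and> (\<lambda>v\<in>V. v) \<in> H \<and>
     (\<forall>g\<in>H. \<forall>h\<in>H. compose V g h \<in> H) \<and> (\<forall>g\<in>H. tinv g \<in> H)"
  then have "\<And>g. g \<in> H \<Longrightarrow> g \<in> tree_aut T" by auto
  then show "subgroup H (AutT T)"
    by (intro subgroup.intro) (use H in \<open>auto simp: AutT_carrier AutT_mult AutT_one AutT_inv\<close>)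
qed

lemma tree_aut_gdist_le:
  assumes g: "g \<in> tree_aut T" and V: "u \<in> V" "v \<in> V"
  shows "d (g u) (g v) \<le> d u v"
proof -
  obtain xs where xs: "walk T xs" "hd xs = u" "last xs = v" "length xs = Suc (d u v)"
    using gdist_walk[OF V] by metis
  then have "xs \<noteq> []" by auto
  have "walk T (map g xs)"
    using xs(1) tree_aut_mem[OF g] tree_aut_adj[OF g]
    by (auto simp: walk_def successively_map elim!: successively_mono)
  then show ?thesis
    using xs \<open>xs \<noteq> []\<close> by (intro gdist_le[of "map g xs"]) (auto simp: hd_map last_map)
qed

text \<open>The inequality is applied to \<open>g\<close> and to its inverse.\<close>

lemma tree_aut_gdist:
  assumes g: "g \<in> tree_aut T" and V: "u \<in> V" "v \<in> V"
  shows "d (g u) (g v) = d u v"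
  using tree_aut_gdist_le[OF g V]
    tree_aut_gdist_le[OF tree_aut_tinv[OF g] tree_aut_mem[OF g V(1)] tree_aut_mem[OF g V(2)]]
    tinv_left[OF tree_aut_Bij[OF g]] V by simp

text \<open>\<open>g\<close> is an isometry and fixes \<open>L\<close>, so \<open>v\<close> and
  \<open>g v\<close> have the same distances to \<open>L\<close> and the choice is made from the
  same minimisers.\<close>

lemma proj_path_fixed:
  assumes g: "g \<in> tree_aut T" and fixes_L: "\<And>x. x \<in> L \<Longrightarrow> g x = x" and L: "L \<subseteq> V" and v: "v \<in> V"
  shows "proj_path T L (g v) = proj_path T L v"
proof -
  have "d (g v) x = d v x" if "x \<in> L" for x
    using tree_aut_gdist[OF g v, of x] fixes_L[OF that] L that by auto
  then have "is_arg_min (d (g v)) (\<lambda>x. x \<in> L) = is_arg_min (d v) (\<lambda>x. x \<in> L)"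
    by (intro ext) (auto simp: is_arg_min_def)
  then show ?thesis by (simp add: proj_path_def arg_min_on_def arg_min_def)
qed

section \<open>The \<open>(P)\<close>-closure\<close>

text \<open>The explicit description of the \<open>(P)\<close>-closure; the matching element of
  \<open>G\<close> may vary with the centre \<open>v\<close> and with \<open>X\<close>.\<close>

definition local_closure :: "('v \<Rightarrow> 'v) set \<Rightarrow> ('v \<Rightarrow> 'v) set" where
  "local_closure G = {g \<in> tree_aut T. \<forall>v\<in>V. \<forall>X. finite X \<longrightarrow> (\<forall>w\<in>X. w = v \<or> adj T v w) \<longrightarrow>
     (\<exists>h\<in>G. \<forall>w\<in>X. g w = h w)}"

lemma local_closureD:
  assumes "g \<in> local_closure G" "v \<in> V" "finite X" "\<And>w. w \<in> X \<Longrightarrow> w = v \<or> adj T v w"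
  obtains h where "h \<in> G" "\<And>w. w \<in> X \<Longrightarrow> g w = h w"
proof -
  have "finite X \<longrightarrow> (\<forall>w\<in>X. w = v \<or> adj T v w) \<longrightarrow> (\<exists>h\<in>G. \<forall>w\<in>X. g w = h w)"
    using assms(1,2) unfolding local_closure_def by simp
  then show ?thesis using assms(3,4) that by metis
qed

lemma local_closure_aut: "g \<in> local_closure G \<Longrightarrow> g \<in> tree_aut T"
  unfolding local_closure_def by auto

lemma local_closure_superset: "G \<subseteq> tree_aut T \<Longrightarrow> G \<subseteq> local_closure G"
  unfolding local_closure_def by auto

lemma subgroup_local_closure:
  assumes G: "subgroup G (AutT T)"
  shows "subgroup (local_closure G) (AutT T)"
proof -
  have G': "G \<subseteq> tree_aut T" "(\<lambda>v\<in>V. v) \<in> G" "\<And>g h. g \<in> G \<Longrightarrow> h \<in> G \<Longrightarrow> compose V g h \<in> G"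
    "\<And>g. g \<in> G \<Longrightarrow> tinv g \<in> G"
    using G unfolding subgroup_AutT_iff by auto
  have "compose V g h \<in> local_closure G" if g: "g \<in> local_closure G" and h: "h \<in> local_closure G" for g h
    unfolding local_closure_def
  proof (intro CollectI conjI ballI allI impI)
    note aut = local_closure_aut[OF g] local_closure_aut[OF h]
    show "compose V g h \<in> tree_aut T" using aut by (rule tree_aut_compose)
    fix v X assume v: "v \<in> V" and X: "finite X" "\<forall>w\<in>X. w = v \<or> adj T v w"
    then have XV: "w \<in> V" if "w \<in> X" for w using that by (auto dest: adj_verts)
    obtain h' where h': "h' \<in> G" "\<And>w. w \<in> X \<Longrightarrow> h w = h' w"
      using local_closureD[OF h v X(1)] X(2) by metis
    \<comment> \<open>Automorphisms carry balls to balls, so \<open>g\<close> can be matched on the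
      image of \<open>X\<close> and the two matching elements composed.\<close>
    have "w = h v \<or> adj T (h v) w" if "w \<in> h ` X" for w
      using that X(2) tree_aut_adj[OF aut(2)] by auto
    then obtain g' where g': "g' \<in> G" "\<And>w. w \<in> h ` X \<Longrightarrow> g w = g' w"
      using local_closureD[OF g tree_aut_mem[OF aut(2) v] finite_imageI[OF X(1)]] by metis
    have "compose V g h w = compose V g' h' w" if "w \<in> X" for w
      using g'(2)[OF imageI[OF that]] h'(2)[OF that] XV[OF that] by (simp add: compose_eq)
    then show "\<exists>k\<in>G. \<forall>w\<in>X. compose V g h w = k w"
      using G'(3)[OF g'(1) h'(1)] by blast
  qed
  moreover have "tinv g \<in> local_closure G" if g: "g \<in> local_closure G" for g
    unfolding local_closure_def
  proof (intro CollectI conjI ballI allI impI)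
    note aut = local_closure_aut[OF g]
    show inv: "tinv g \<in> tree_aut T" using aut by (rule tree_aut_tinv)
    fix v X assume v: "v \<in> V" and X: "finite X" "\<forall>w\<in>X. w = v \<or> adj T v w"
    then have XV: "w \<in> V" if "w \<in> X" for w using that by (auto dest: adj_verts)
    \<comment> \<open>Matching \<open>g\<close> by \<open>h\<close> on the preimage of
      \<open>X\<close> makes the inverses agree on \<open>X\<close>.\<close>
    have "w = tinv g v \<or> adj T (tinv g v) w" if "w \<in> tinv g ` X" for w
      using that X(2) tree_aut_adj[OF inv] by auto
    then obtain h where h: "h \<in> G" "\<And>w. w \<in> tinv g ` X \<Longrightarrow> g w = h w"
      using local_closureD[OF g tree_aut_mem[OF inv v] finite_imageI[OF X(1)]] by metis
    have "tinv g w = tinv h w" if w: "w \<in> X" for w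
    proof -
      have "h (tinv g w) = w"
        using h(2)[OF imageI[OF w]] tinv_right[OF tree_aut_Bij[OF aut] XV[OF w]] by simp
      moreover have "h \<in> Bij V" using h(1) G'(1) tree_aut_Bij by blast
      ultimately show ?thesis
        using tinv_left[of h "tinv g w"] tree_aut_mem[OF inv XV[OF w]] by simp
    qed
    then show "\<exists>k\<in>G. \<forall>w\<in>X. tinv g w = k w" using G'(4)[OF h(1)] by blast
  qed
  ultimately show ?thesis
    using local_closure_superset[OF G'(1)] G'(2) local_closure_aut
    unfolding subgroup_AutT_iff by blast
qed

section \<open>Closed sets of automorphisms\<close>

lemma topspace_aut_topology: "topspace (aut_topology T) = tree_aut T"
proof -
  have "openin (perm_topology V) (Bij V)" unfolding openin_perm_topology by blast
  then have "Bij V \<subseteq> topspace (perm_topology V)" by (rule openin_subset)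
  then show ?thesis using tree_aut_Bij unfolding aut_topology_def by auto
qed

text \<open>Failure to belong is witnessed on a finite set \<open>X\<close> and is shared by every
  permutation that agrees with \<open>g\<close> on \<open>X\<close>; hence the complement is
  open.\<close>

lemma closedin_local_closure: "closedin (aut_topology T) (local_closure G)"
  unfolding closedin_def
proof
  show "local_closure G \<subseteq> topspace (aut_topology T)"
    using topspace_aut_topology local_closure_aut by auto
  define S where "S = {g \<in> Bij V. \<exists>v\<in>V. \<exists>X. finite X \<and> (\<forall>w\<in>X. w = v \<or> adj T v w) \<and>
    (\<forall>h\<in>G. \<exists>w\<in>X. g w \<noteq> h w)}"
  have "openin (perm_topology V) S"
    unfolding openin_perm_topology
  proof (intro conjI ballI)
    show "S \<subseteq> Bij V" unfolding S_def by auto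
    fix g assume "g \<in> S"
    then obtain v X where X: "v \<in> V" "finite X" "\<forall>w\<in>X. w = v \<or> adj T v w"
      "\<forall>h\<in>G. \<exists>w\<in>X. g w \<noteq> h w" unfolding S_def by blast
    then have "X \<subseteq> V" by (auto dest: adj_verts)
    moreover have "{h \<in> Bij V. \<forall>x\<in>X. h x = g x} \<subseteq> S" unfolding S_def using X by fastforce
    ultimately show "\<exists>F. finite F \<and> F \<subseteq> V \<and> {h \<in> Bij V. \<forall>x\<in>F. h x = g x} \<subseteq> S"
      using X by blast
  qed
  moreover have "g \<in> tree_aut T - local_closure G \<longleftrightarrow> g \<in> S \<inter> tree_aut T" for g
    unfolding S_def local_closure_def using tree_aut_Bij[of g] by auto
  then have "tree_aut T - local_closure G = S \<inter> tree_aut T" by blast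
  ultimately show "openin (aut_topology T) (topspace (aut_topology T) - local_closure G)"
    unfolding topspace_aut_topology unfolding aut_topology_def openin_subtopology by blast
qed

text \<open>Otherwise some basic neighbourhood of \<open>g\<close>, given by a finite set, would
  avoid \<open>K\<close>.\<close>

lemma closedin_aut_topologyI:
  assumes K: "closedin (aut_topology T) K" and g: "g \<in> tree_aut T"
    and approx: "\<And>F. finite F \<Longrightarrow> F \<subseteq> V \<Longrightarrow> \<exists>k\<in>K. \<forall>x\<in>F. k x = g x"
  shows "g \<in> K"
proof (rule ccontr)
  assume "g \<notin> K"
  have sub: "K \<subseteq> tree_aut T" using closedin_subset[OF K] topspace_aut_topology by simp
  obtain S where S: "openin (perm_topology V) S" "tree_aut T - K = S \<inter> tree_aut T"
    using K unfolding closedin_def topspace_aut_topology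
    unfolding aut_topology_def openin_subtopology by blast
  then have "g \<in> S" using g \<open>g \<notin> K\<close> by blast
  then obtain F where F: "finite F" "F \<subseteq> V" "{h \<in> Bij V. \<forall>x\<in>F. h x = g x} \<subseteq> S"
    using S(1) unfolding openin_perm_topology by blast
  obtain k where "k \<in> K" "\<forall>x\<in>F. k x = g x" using approx F by blast
  then show False using F(3) S(2) sub tree_aut_Bij by blast
qed

section \<open>Gluing along the fibres of the projection\<close>

text \<open>Each vertex is moved by the map attached to its projection. This is the candidate
  preimage of a tuple in the product of property \<open>(P)\<close>.\<close>

definition glue :: "'v set \<Rightarrow> ('v \<Rightarrow> 'v \<Rightarrow> 'v) \<Rightarrow> 'v \<Rightarrow> 'v" where
  "glue L s = (\<lambda>v\<in>V. s (proj_path T L v) v)"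

text \<open>Neighbours on the path are fixed by every \<open>s x\<close>, and all other neighbours of a vertex have
  the same projection as that vertex.\<close>

lemma glue_near:
  assumes p: "simple_path T I p"
    and s: "\<And>x. x \<in> p ` I \<Longrightarrow> s x \<in> pointwise_stab (tree_aut T) (p ` I)"
    and v: "v \<in> V" and w: "w = v \<or> adj T v w"
  shows "glue (p ` I) s w = s (proj_path T (p ` I) v) w"
proof -
  note L = simple_path_subset[OF p]
  have wV: "w \<in> V" using v w adj_verts by blast
  show ?thesis
  proof (cases "w \<in> p ` I")
    case True
    then have "s x w = w" if "x \<in> p ` I" for x using s[OF that] unfolding pointwise_stab_def by blast
    then show ?thesis using proj_path_le(1) L wV unfolding glue_def by simp
  next
    case False
    then have "proj_path T (p ` I) w = proj_path T (p ` I) v"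
      using w proj_path_adj[OF p] adj_sym by metis
    then show ?thesis using wV unfolding glue_def by simp
  qed
qed

text \<open>Every \<open>s x\<close> fixes \<open>L\<close> and so preserves the fibres; this allows
  the glued map to be inverted fibre by fibre.\<close>

lemma glue_proj:
  assumes L: "L \<subseteq> V" "L \<noteq> {}" and s: "\<And>x. x \<in> L \<Longrightarrow> s x \<in> pointwise_stab (tree_aut T) L"
    and v: "v \<in> V"
  shows "glue L s v \<in> V" "proj_path T L (glue L s v) = proj_path T L v"
proof -
  define x where "x = proj_path T L v"
  have "s x \<in> tree_aut T" "\<And>y. y \<in> L \<Longrightarrow> s x y = y"
    using s proj_path_le(1)[OF L(2)] unfolding x_def pointwise_stab_def by auto
  then show "glue L s v \<in> V" "proj_path T L (glue L s v) = proj_path T L v"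
    using v tree_aut_mem proj_path_fixed L(1) unfolding glue_def x_def by auto
qed

lemma pointwise_stab_tinv:
  assumes "g \<in> pointwise_stab (tree_aut T) L" "L \<subseteq> V"
  shows "tinv g \<in> pointwise_stab (tree_aut T) L"
proof -
  have g: "g \<in> tree_aut T" "\<And>x. x \<in> L \<Longrightarrow> g x = x" using assms unfolding pointwise_stab_def by auto
  have "tinv g x = x" if "x \<in> L" for x
    using tinv_left[OF tree_aut_Bij[OF g(1)], of x] g(2)[OF that] assms(2) that by auto
  then show ?thesis using tree_aut_tinv[OF g(1)] unfolding pointwise_stab_def by blast
qed

text \<open>By \<open>glue_near\<close> one automorphism moves both ends of an edge, so adjacency is
  preserved. The inverse is glued from the inverses.\<close>

lemma glue_aut:
  assumes p: "simple_path T I p"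
    and s: "\<And>x. x \<in> p ` I \<Longrightarrow> s x \<in> pointwise_stab (tree_aut T) (p ` I)"
  shows "glue (p ` I) s \<in> tree_aut T"
proof -
  define L where "L = p ` I"
  have L: "L \<subseteq> V" "L \<noteq> {}" using simple_path_subset[OF p] unfolding L_def by auto
  define s' where "s' x = tinv (s x)" for x
  have sL: "\<And>x. x \<in> L \<Longrightarrow> s x \<in> pointwise_stab (tree_aut T) L" using s unfolding L_def .
  then have s'L: "\<And>x. x \<in> L \<Longrightarrow> s' x \<in> pointwise_stab (tree_aut T) L"
    unfolding s'_def using pointwise_stab_tinv L by blast
  have aut: "s x \<in> tree_aut T" if "x \<in> L" for x using sL[OF that] unfolding pointwise_stab_def by blast
  \<comment> \<open>A general family \<open>t\<close> covers both \<open>s\<close> and the family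
    \<open>s'\<close> of inverses.\<close>
  have adj: "adj T (glue L t u) (glue L t v)"
    if t: "\<And>x. x \<in> L \<Longrightarrow> t x \<in> pointwise_stab (tree_aut T) L" and uv: "adj T u v" for t u v
  proof -
    have u: "u \<in> V" using uv adj_verts by blast
    have "t (proj_path T L u) \<in> tree_aut T"
      using t proj_path_le(1)[OF L(2)] unfolding pointwise_stab_def by blast
    then show ?thesis
      using glue_near[OF p, of t u] t u uv tree_aut_adj unfolding L_def by metis
  qed
  have gs: "glue L s v \<in> V" "proj_path T L (glue L s v) = proj_path T L v"
    and gs': "glue L s' v \<in> V" "proj_path T L (glue L s' v) = proj_path T L v" if "v \<in> V" for v
    using glue_proj[of L s v] glue_proj[of L s' v] L sL s'L that by blast+
  have left: "glue L s' (glue L s v) = v" and right: "glue L s (glue L s' v) = v" if v: "v \<in> V" for v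
  proof -
    have B: "s (proj_path T L v) \<in> Bij V"
      using aut[OF proj_path_le(1)[OF L(2)]] by (rule tree_aut_Bij)
    have glue: "glue L t v = t (proj_path T L v) v" for t using v by (simp add: glue_def)
    have "glue L s' (glue L s v) = s' (proj_path T L (glue L s v)) (glue L s v)"
      using gs(1)[OF v] unfolding glue_def[of L s'] by simp
    then show "glue L s' (glue L s v) = v"
      unfolding gs(2)[OF v] using tinv_left[OF B v] by (simp add: glue s'_def)
    have "glue L s (glue L s' v) = s (proj_path T L (glue L s' v)) (glue L s' v)"
      using gs'(1)[OF v] unfolding glue_def[of L s] by simp
    then show "glue L s (glue L s' v) = v"
      unfolding gs'(2)[OF v] using tinv_right[OF B v] by (simp add: glue s'_def)
  qed
  have "bij_betw (glue L s) V V"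
    by (rule bij_betw_byWitness[where f' = "glue L s'"])
       (use left right gs(1) gs'(1) in auto)
  then have B: "glue L s \<in> Bij V" unfolding Bij_def by (simp add: glue_def)
  have "tinv (glue L s) v = glue L s' v" if v: "v \<in> V" for v
    using tinv_left[OF B gs'(1)[OF v]] right[OF v] by simp
  then have "adj T (tinv (glue L s) u) (tinv (glue L s) v)" if "adj T u v" for u v
    using adj[of s', OF s'L that] adj_verts[OF that] by simp
  moreover have "adj T (glue L s u) (glue L s v)" if "adj T u v" for u v
    using adj[of s, OF sL that] by simp
  ultimately show ?thesis using tree_autI[OF B] unfolding L_def by blast
qed

lemma property_P_local_closure: "property_P T (local_closure G)"
  unfolding property_P_def Let_def
proof (intro allI impI)
  fix I p assume p: "simple_path T I p"
  define L where "L = p ` I"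
  define S where "S = pointwise_stab (local_closure G) L"
  have L: "L \<subseteq> V" "L \<noteq> {}" using simple_path_subset[OF p] unfolding L_def by auto
  have "f \<in> (\<lambda>g. \<lambda>x\<in>L. restrict g (fibre T L x)) ` S"
    if f: "f \<in> (\<Pi>\<^sub>E x\<in>L. (\<lambda>g. restrict g (fibre T L x)) ` S)" for f
  proof -
    \<comment> \<open>Each component of the tuple has its own representative \<open>s x\<close>;
      gluing them gives the preimage.\<close>
    have "\<forall>x\<in>L. \<exists>g\<in>S. f x = restrict g (fibre T L x)" using f by (fastforce simp: PiE_iff)
    then obtain s where s: "\<And>x. x \<in> L \<Longrightarrow> s x \<in> S \<and> f x = restrict (s x) (fibre T L x)" by metis
    have stab: "s x \<in> pointwise_stab (tree_aut T) L" if "x \<in> L" for x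
      using s[OF that] local_closure_aut unfolding S_def pointwise_stab_def by blast
    have near: "glue L s w = s (proj_path T L v) w" if "v \<in> V" "w = v \<or> adj T v w" for v w
      using glue_near[OF p, of s v w] stab that unfolding L_def by blast
    have "glue L s \<in> local_closure G"
      unfolding local_closure_def
    proof (intro CollectI conjI ballI allI impI)
      show "glue L s \<in> tree_aut T" using glue_aut[OF p, of s] stab unfolding L_def by blast
      fix v X assume v: "v \<in> V" and X: "finite X" "\<forall>w\<in>X. w = v \<or> adj T v w"
      \<comment> \<open>On the ball around \<open>v\<close> the glued map is this one automorphism,
        so a match for it in \<open>G\<close> also matches the glued map.\<close>
      have "s (proj_path T L v) \<in> local_closure G"
        using s proj_path_le(1)[OF L(2)] unfolding S_def pointwise_stab_def by blast
      then obtain h where "h \<in> G" "\<And>w. w \<in> X \<Longrightarrow> s (proj_path T L v) w = h w"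
        using local_closureD[OF _ v X(1)] X(2) by metis
      then show "\<exists>h\<in>G. \<forall>w\<in>X. glue L s w = h w" using near[OF v] X(2) by metis
    qed
    moreover have "glue L s x = x" if "x \<in> L" for x
      using that L stab[OF that] by (auto simp: glue_def proj_path_self pointwise_stab_def)
    ultimately have "glue L s \<in> S" unfolding S_def pointwise_stab_def by blast
    moreover have "f = (\<lambda>x\<in>L. restrict (glue L s) (fibre T L x))"
    proof
      fix x show "f x = (\<lambda>x\<in>L. restrict (glue L s) (fibre T L x)) x"
      proof (cases "x \<in> L")
        case True
        then show ?thesis using s[OF True] by (auto simp: fibre_def glue_def restrict_def)
      next
        case False
        then show ?thesis using f by (auto simp: PiE_iff extensional_def)
      qed
    qed
    ultimately show ?thesis by blast
  qed
  then show "(\<lambda>g. \<lambda>x\<in>p ` I. restrict g (fibre T (p ` I) x)) ` pointwise_stab (local_closure G) (p ` I) =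
    (\<Pi>\<^sub>E x\<in>p ` I. (\<lambda>g. restrict g (fibre T (p ` I) x)) ` pointwise_stab (local_closure G) (p ` I))"
    unfolding S_def L_def by (intro equalityI subsetI) auto
qed

section \<open>Amalgamation over an edge\<close>

lemma edge_simple_path:
  assumes "adj T x y" shows "simple_path T {0, 1} (\<lambda>i. if i = 0 then x else y)"
proof -
  define p :: "int \<Rightarrow> 'v" where "p = (\<lambda>i. if i = 0 then x else y)"
  have p: "p 0 = x" "p 1 = y" unfolding p_def by simp_all
  have "\<forall>i\<in>{0, 1}. \<forall>k\<in>{0, 1}. {i..k} \<subseteq> {0, 1 :: int}" by auto
  moreover have "adj T (p i) (p (i + 1))" if "i \<in> {0, 1} \<and> i + 1 \<in> {0, 1}" for i
  proof -
    have "i = 0" using that by auto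
    then show ?thesis using assms p by simp
  qed
  moreover have "p ` {0, 1} \<subseteq> V" "inj_on p {0, 1}"
    using adj_verts[OF assms] adj_irrefl[OF assms] p by auto
  ultimately show ?thesis unfolding simple_path_def p_def by blast
qed

text \<open>The fibres of a path of length one are the two half-trees of its edge. Surjectivity is
  applied to the pair made of the identity on one of them and \<open>g\<close> on the other.\<close>

lemma property_P_edge:
  assumes P: "property_P T K" and K: "(\<lambda>v\<in>V. v) \<in> K" and xy: "adj T x y"
    and g: "g \<in> K" "g x = x" "g y = y"
  obtains h where "h \<in> K" "\<And>v. v \<in> V \<Longrightarrow> d v x < d v y \<Longrightarrow> h v = v"
    "\<And>v. v \<in> V \<Longrightarrow> d v y < d v x \<Longrightarrow> h v = g v"
proof -
  define L where "L = {x, y}"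
  define S where "S = pointwise_stab K L"
  note V = adj_verts[OF xy] and ne = adj_irrefl[OF xy]
  have "(\<lambda>i::int. if i = 0 then x else y) ` {0, 1} = L" unfolding L_def by auto
  then have P': "(\<lambda>g. \<lambda>x\<in>L. restrict g (fibre T L x)) ` S
      = (\<Pi>\<^sub>E x\<in>L. (\<lambda>g. restrict g (fibre T L x)) ` S)"
    using P edge_simple_path[OF xy] unfolding property_P_def Let_def S_def by metis
  define s where "s z = (if z = x then (\<lambda>v\<in>V. v) else g)" for z
  have "s z \<in> S" for z using K g V unfolding S_def s_def pointwise_stab_def L_def by auto
  then have "(\<lambda>z\<in>L. restrict (s z) (fibre T L z)) \<in> (\<Pi>\<^sub>E x\<in>L. (\<lambda>g. restrict g (fibre T L x)) ` S)"
    by auto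
  then obtain h where h: "h \<in> S"
    "(\<lambda>z\<in>L. restrict (s z) (fibre T L z)) = (\<lambda>x\<in>L. restrict h (fibre T L x))"
    unfolding P'[symmetric] by blast
  have eq: "h v = s z v" if "z \<in> L" "v \<in> fibre T L z" for v z
    using fun_cong[OF fun_cong[OF h(2), of z], of v] that by simp
  have "h v = v" if "v \<in> V" "d v x < d v y" for v
  proof -
    have "v \<in> fibre T L x" using that by (auto simp: fibre_def L_def intro!: proj_path_eqI)
    then show ?thesis using eq[of x v] that by (simp add: s_def L_def)
  qed
  moreover have "h v = g v" if "v \<in> V" "d v y < d v x" for v
  proof -
    have "v \<in> fibre T L y" using that by (auto simp: fibre_def L_def intro!: proj_path_eqI)
    then show ?thesis using eq[of y v] ne by (simp add: s_def L_def)
  qed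
  ultimately show ?thesis using that h(1) unfolding S_def pointwise_stab_def by blast
qed

text \<open>The inverse of \<open>k\<close> times \<open>k'\<close> fixes both ends of the edge.
  \<open>property_P_edge\<close> makes it trivial on the side of \<open>x\<close>, and multiplying
  by \<open>k\<close> on the left gives \<open>h\<close>.\<close>

lemma P_closed_amalgamate:
  assumes K: "subgroup K (AutT T)" and P: "property_P T K" and xy: "adj T x y"
    and k: "k \<in> K" "k' \<in> K" "k x = k' x" "k y = k' y"
  obtains h where "h \<in> K" "\<And>v. v \<in> V \<Longrightarrow> d v x < d v y \<Longrightarrow> h v = k v"
    "\<And>v. v \<in> V \<Longrightarrow> d v y < d v x \<Longrightarrow> h v = k' v"
proof -
  have K': "K \<subseteq> tree_aut T" "(\<lambda>v\<in>V. v) \<in> K" "\<And>g h. g \<in> K \<Longrightarrow> h \<in> K \<Longrightarrow> compose V g h \<in> K"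
    "\<And>g. g \<in> K \<Longrightarrow> tinv g \<in> K"
    using K unfolding subgroup_AutT_iff by auto
  note V = adj_verts[OF xy]
  have aut: "k \<in> tree_aut T" "k' \<in> tree_aut T" using k K' by auto
  define g where "g = compose V (tinv k) k'"
  have "g \<in> K" unfolding g_def using k K' by blast
  moreover have "g x = x" "g y = y"
    using V k tinv_left[OF tree_aut_Bij[OF aut(1)]] unfolding g_def
    by (metis compose_eq)+
  ultimately obtain h where h: "h \<in> K" "\<And>v. v \<in> V \<Longrightarrow> d v x < d v y \<Longrightarrow> h v = v"
    "\<And>v. v \<in> V \<Longrightarrow> d v y < d v x \<Longrightarrow> h v = g v"
    using property_P_edge[OF P K'(2) xy] by metis
  have "k (g v) = k' v" if "v \<in> V" for v
    using that tinv_right[OF tree_aut_Bij[OF aut(1)]] tree_aut_mem[OF aut(2)]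
    unfolding g_def by (simp add: compose_eq)
  then show ?thesis
    using that[OF K'(3)[OF k(1) h(1)]] h by (simp add: compose_eq)
qed

text \<open>Induction on the radius: the star of \<open>x\<close> is matched first, and the branches at its
  neighbours are then corrected one at a time by amalgamation over the edge to the branch.\<close>

lemma P_closed_approx:
  assumes K: "subgroup K (AutT T)" and P: "property_P T K"
    and g: "g \<in> local_closure K"
  shows "x \<in> V \<Longrightarrow> finite F \<Longrightarrow> F \<subseteq> {v \<in> V. d v x \<le> Suc n} \<Longrightarrow> \<exists>k\<in>K. \<forall>v\<in>F. k v = g v"
proof (induction n arbitrary: x F)
  \<comment> \<open>The radius is \<open>Suc n\<close>, so the base case is a ball of radius one,
    where \<open>local_closure\<close> applies directly.\<close>
  case 0
  have "v = x \<or> adj T x v" if "v \<in> F" for v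
  proof (cases "d x v")
    case 0
    then show ?thesis using gdist_eq_0 \<open>x \<in> V\<close> that \<open>F \<subseteq> _\<close> by auto
  next
    case (Suc m)
    have v: "v \<in> V" "d v x \<le> 1" using that \<open>F \<subseteq> _\<close> by auto
    then have "d x v = Suc 0" using Suc gdist_commute[OF v(1) \<open>x \<in> V\<close>] by simp
    then obtain y where "adj T v y" "d x y = 0" using gdist_parent[OF \<open>x \<in> V\<close> v(1)] by metis
    then show ?thesis using gdist_eq_0 \<open>x \<in> V\<close> adj_verts adj_sym by metis
  qed
  then show ?case using local_closureD[OF g \<open>x \<in> V\<close> \<open>finite F\<close>] by metis
next
  case (Suc n)
  \<comment> \<open>\<open>B y\<close> is the part of \<open>F\<close> in the branch at
    \<open>y\<close>. Only neighbours with a nonempty part enter \<open>N\<close>, which keeps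
    \<open>N\<close> finite at vertices of infinite degree.\<close>
  define B where "B y = {v \<in> F. d v y < d v x}" for y
  define N where "N = {y. adj T x y \<and> B y \<noteq> {}}"
  have FV: "v \<in> F \<Longrightarrow> v \<in> V" for v using Suc.prems by auto
  have branch: "\<exists>y\<in>N. v \<in> B y" if v: "v \<in> F" "v \<noteq> x" for v
  proof -
    have "d v x \<noteq> 0" using gdist_eq_0 v FV Suc.prems by blast
    then obtain m where "d v x = Suc m" using not0_implies_Suc by blast
    then obtain y where "adj T x y" "d v y < d v x"
      using gdist_parent[OF FV[OF v(1)] Suc.prems(1)] by (metis lessI)
    then show ?thesis using v unfolding N_def B_def by blast
  qed
  have branch_unique: "y = z" if "adj T x y" "adj T x z" "v \<in> B y" "v \<in> B z" for v y z
    using that FV gdist_parent_unique unfolding B_def by blast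
  \<comment> \<open>Each \<open>y\<close> in \<open>N\<close> is recovered from any vertex of
    \<open>B y\<close>, so the finite set \<open>F\<close> bounds \<open>N\<close>.\<close>
  have "N \<subseteq> (\<lambda>v. THE y. adj T x y \<and> v \<in> B y) ` F"
  proof
    fix y assume "y \<in> N"
    then obtain v where v: "adj T x y" "v \<in> B y" unfolding N_def by blast
    then have "(THE y. adj T x y \<and> v \<in> B y) = y" using branch_unique by (intro the_equality) auto
    moreover have "v \<in> F" using v unfolding B_def by blast
    ultimately show "y \<in> (\<lambda>v. THE y. adj T x y \<and> v \<in> B y) ` F" by force
  qed
  then have finN: "finite N" using Suc.prems(2) by (rule finite_surj[rotated])
  \<comment> \<open>\<open>M\<close> collects the branches already corrected. All of
    \<open>N\<close> stays matched meanwhile, so that amalgamation is possible at the next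
    neighbour.\<close>
  have "M \<subseteq> N \<Longrightarrow> \<exists>k\<in>K. \<forall>v\<in>{x} \<union> N \<union> \<Union>(B ` M). k v = g v" if "finite M" for M
    using that
  proof induction
    case empty
    have "w = x \<or> adj T x w" if "w \<in> {x} \<union> N" for w using that unfolding N_def by auto
    then obtain k where "k \<in> K" "\<And>w. w \<in> {x} \<union> N \<Longrightarrow> g w = k w"
      using local_closureD[OF g Suc.prems(1), of "{x} \<union> N"] finN by (metis finite.emptyI finite.insertI finite_UnI)
    then show ?case by force
  next
    case (insert y M)
    then obtain k where k: "k \<in> K" "\<And>v. v \<in> {x} \<union> N \<union> \<Union>(B ` M) \<Longrightarrow> k v = g v" by auto
    have y: "y \<in> N" and xy: "adj T x y" using insert unfolding N_def by auto
    note yV = conjunct2[OF adj_verts[OF xy]]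
    \<comment> \<open>Seen from \<open>y\<close>, its branch has radius one less and
      \<open>x\<close> is at distance one, so the induction hypothesis applies.\<close>
    have "{x, y} \<union> B y \<subseteq> {v \<in> V. d v y \<le> Suc n}"
    proof
      fix v assume "v \<in> {x, y} \<union> B y"
      then consider "v = x" | "v = y" | "v \<in> B y" by blast
      then show "v \<in> {v \<in> V. d v y \<le> Suc n}"
      proof cases
        case 1
        then show ?thesis using gdist_step[OF Suc.prems(1) xy] Suc.prems(1) by simp
      next
        case 2
        then show ?thesis using yV by simp
      next
        case 3
        then have "v \<in> V" "d v y < d v x" "d v x \<le> Suc (Suc n)"
          using Suc.prems(3) unfolding B_def by auto
        then show ?thesis by simp
      qed
    qed
    moreover have "finite ({x, y} \<union> B y)" using Suc.prems(2) unfolding B_def by simp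
    ultimately obtain k' where k': "k' \<in> K" "\<forall>v\<in>{x, y} \<union> B y. k' v = g v"
      using Suc.IH[OF yV] by blast
    have "k x = k' x" "k y = k' y" using k k' y by auto
    then obtain h where h: "h \<in> K" "\<And>v. v \<in> V \<Longrightarrow> d v x < d v y \<Longrightarrow> h v = k v"
      "\<And>v. v \<in> V \<Longrightarrow> d v y < d v x \<Longrightarrow> h v = k' v"
      using P_closed_amalgamate[OF K P xy k(1) k'(1)] by metis
    have "h v = g v" if v: "v \<in> {x} \<union> N \<union> \<Union>(B ` insert y M)" for v
    proof -
      have vV: "v \<in> V" using v Suc.prems(1) FV adj_verts unfolding N_def B_def by blast
      have cases: "v = y \<or> v \<in> B y \<or> v \<in> {x} \<union> N \<union> \<Union>(B ` M)" using v by auto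
      show ?thesis
      proof (cases "d v y < d v x")
        case True
        \<comment> \<open>A vertex of \<open>N\<close> is the neighbour of \<open>x\<close> closest
          to itself, so the only one on the side of \<open>y\<close> is \<open>y\<close>.\<close>
        have "v \<in> {x, y} \<union> B y"
        proof (rule ccontr)
          assume no: "v \<notin> {x, y} \<union> B y"
          then have "v \<notin> F" using True unfolding B_def by blast
          then have "v \<in> N" using v no unfolding B_def by auto
          then have xv: "adj T x v" unfolding N_def by blast
          have "d v v < d v x"
            using vV gdist_adj_neq[OF vV xv] by simp
          then have "v = y" using gdist_parent_unique[OF vV xv xy] True by simp
          then show False using no by blast
        qed
        then show ?thesis using h(3)[OF vV True] k' by simp
      next
        case False
        then have "d v x < d v y" using gdist_adj_neq[OF vV xy] by linarith
        \<comment> \<open>On the side of \<open>x\<close> only vertices already matched by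
          \<open>k\<close> occur.\<close>
        moreover have "v \<in> {x} \<union> N \<union> \<Union>(B ` M)" using cases y False unfolding B_def by auto
        ultimately show ?thesis using h(2)[OF vV] k(2) by simp
      qed
    qed
    then show ?case using h(1) by blast
  qed
  from this[OF finN subset_refl] obtain k where
    "k \<in> K" "\<forall>v\<in>{x} \<union> N \<union> \<Union>(B ` N). k v = g v" by blast
  then show ?case using branch by blast
qed

text \<open>Any finite set lies in a ball about a base vertex, so \<open>P_closed_approx\<close>
  matches \<open>g\<close> on it by an element of \<open>K\<close>; then closedness applies.\<close>

lemma local_closure_minimal:
  assumes K: "P_closed T K" and "G \<subseteq> K"
  shows "local_closure G \<subseteq> K"
proof
  fix g assume "g \<in> local_closure G"
  then have g: "g \<in> local_closure K" using \<open>G \<subseteq> K\<close> unfolding local_closure_def by blast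
  have K': "subgroup K (AutT T)" "closedin (aut_topology T) K" "property_P T K"
    using K unfolding P_closed_def by auto
  obtain x where x: "x \<in> V" using tree unfolding is_tree_def by blast
  show "g \<in> K"
  proof (rule closedin_aut_topologyI[OF K'(2) local_closure_aut[OF g]])
    fix F assume F: "finite F" "F \<subseteq> V"
    \<comment> \<open>For empty \<open>F\<close> the value of \<open>Max\<close> is unspecified, but
      the inclusion is then trivial.\<close>
    define n where "n = Max ((\<lambda>v. d v x) ` F)"
    have "F \<subseteq> {v \<in> V. d v x \<le> Suc n}"
      using F unfolding n_def by (auto intro!: le_SucI Max_ge)
    then show "\<exists>k\<in>K. \<forall>v\<in>F. k v = g v" using P_closed_approx[OF K'(1,3) g x F(1)] by blast
  qed
qed

lemma is_P_closure_local_closure: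
  assumes "subgroup G (AutT T)"
  shows "is_P_closure T G (local_closure G)"
proof -
  have "G \<subseteq> tree_aut T" using assms by (simp add: subgroup_AutT_iff)
  then have "G \<subseteq> local_closure G" by (rule local_closure_superset)
  moreover have "P_closed T (local_closure G)"
    unfolding P_closed_def
    using assms subgroup_local_closure closedin_local_closure property_P_local_closure by simp
  ultimately show ?thesis
    unfolding is_P_closure_def using local_closure_minimal by simp
qed

section \<open>The universal group of the associated diagram\<close>

lemma arc_act_compose:
  assumes "g \<in> tree_aut T" "h \<in> tree_aut T" "a \<in> arcs T"
  shows "arc_act T (compose V g h) a = arc_act T g (arc_act T h a)"
  using assms arc_verts[OF assms(3)]
  by (intro arc_eqI) (simp_all add: arc_act tree_aut_compose compose_eq)

lemma arc_act_tinv: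
  assumes "g \<in> tree_aut T" "a \<in> arcs T"
  shows "arc_act T (tinv g) (arc_act T g a) = a" "arc_act T g (arc_act T (tinv g) a) = a"
  using assms arc_verts[OF assms(2)]
  by (intro arc_eqI; simp add: arc_act tree_aut_tinv tree_aut_Bij tinv_left tinv_right)+

lemma arc_act_out_arcs:
  "g \<in> tree_aut T \<Longrightarrow> b \<in> out_arcs T v \<Longrightarrow> arc_act T g b \<in> out_arcs T (g v)"
  unfolding out_arcs_def by (simp add: arc_act)

text \<open>The inverse comes from \<open>tinv g\<close>. This places the restricted arc actions in
  the space where the closure defining the local group is taken.\<close>

lemma out_arcs_stab_Bij:
  assumes g: "g \<in> tree_aut T" and v: "v \<in> V" "g v = v"
  shows "restrict (arc_act T g) (out_arcs T v) \<in> Bij (out_arcs T v)"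
proof -
  have "tinv g v = v" using tinv_left[OF tree_aut_Bij[OF g] v(1)] v(2) by simp
  then have "arc_act T (tinv g) b \<in> out_arcs T v" "arc_act T g b \<in> out_arcs T v"
    if "b \<in> out_arcs T v" for b
    using arc_act_out_arcs[OF g that] arc_act_out_arcs[OF tree_aut_tinv[OF g] that] v by simp_all
  then have "bij_betw (arc_act T g) (out_arcs T v) (out_arcs T v)"
    by (intro bij_betw_byWitness[where f' = "arc_act T (tinv g)"])
       (auto simp: out_arcs_def arc_act_tinv[OF g])
  then show ?thesis unfolding Bij_def by simp
qed

end

section \<open>Closures in the permutation topology\<close>

text \<open>Agreement with \<open>f\<close> on finite sets describes a base of open neighbourhoods
  of \<open>f\<close>. Here \<open>X\<close> is later the set of arcs at a vertex.\<close>

lemma closure_of_perm_topology: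
  assumes A: "A \<subseteq> Bij X"
  shows "f \<in> perm_topology X closure_of A \<longleftrightarrow>
    f \<in> Bij X \<and> (\<forall>F. finite F \<longrightarrow> F \<subseteq> X \<longrightarrow> (\<exists>h\<in>A. \<forall>x\<in>F. h x = f x))"
proof
  have nbhd: "openin (perm_topology X) {h \<in> Bij X. \<forall>x\<in>F. h x = f x}"
    if F: "finite F" "F \<subseteq> X" for F f
    unfolding openin_perm_topology
  proof (intro conjI ballI)
    fix g assume "g \<in> {h \<in> Bij X. \<forall>x\<in>F. h x = f x}"
    then have "{h \<in> Bij X. \<forall>x\<in>F. h x = g x} \<subseteq> {h \<in> Bij X. \<forall>x\<in>F. h x = f x}" by auto
    then show "\<exists>F'. finite F' \<and> F' \<subseteq> X \<and>
        {h \<in> Bij X. \<forall>x\<in>F'. h x = g x} \<subseteq> {h \<in> Bij X. \<forall>x\<in>F. h x = f x}"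
      using F by blast
  qed blast
  have top: "topspace (perm_topology X) \<subseteq> Bij X"
    using openin_topspace[of "perm_topology X"] unfolding openin_perm_topology by blast
  {
    assume f: "f \<in> perm_topology X closure_of A"
    then have "f \<in> topspace (perm_topology X)" unfolding in_closure_of by simp
    then have fB: "f \<in> Bij X" using top by (rule subsetD[rotated])
    moreover have "\<exists>h\<in>A. \<forall>x\<in>F. h x = f x" if "finite F" "F \<subseteq> X" for F
    proof -
      have "f \<in> {h \<in> Bij X. \<forall>x\<in>F. h x = f x}" using fB by simp
      then have "\<exists>h. h \<in> A \<and> h \<in> {h \<in> Bij X. \<forall>x\<in>F. h x = f x}"
        using f nbhd[OF that, of f] unfolding in_closure_of by meson
      then show ?thesis by blast
    qed
    ultimately show "f \<in> Bij X \<and> (\<forall>F. finite F \<longrightarrow> F \<subseteq> X \<longrightarrow> (\<exists>h\<in>A. \<forall>x\<in>F. h x = f x))"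
      by blast
  }
  assume f: "f \<in> Bij X \<and> (\<forall>F. finite F \<longrightarrow> F \<subseteq> X \<longrightarrow> (\<exists>h\<in>A. \<forall>x\<in>F. h x = f x))"
  show "f \<in> perm_topology X closure_of A"
    unfolding in_closure_of
  proof (intro conjI allI impI)
    \<comment> \<open>The neighbourhood given by the empty set is all of
      \<open>Bij X\<close>.\<close>
    show "f \<in> topspace (perm_topology X)"
      using openin_subset[OF nbhd[of "{}" f]] f by auto
    fix U assume U: "f \<in> U \<and> openin (perm_topology X) U"
    then obtain F where F: "finite F" "F \<subseteq> X" "{h \<in> Bij X. \<forall>x\<in>F. h x = f x} \<subseteq> U"
      unfolding openin_perm_topology by blast
    then obtain h where "h \<in> A" "\<forall>x\<in>F. h x = f x" using f by blast
    then show "\<exists>y. y \<in> A \<and> y \<in> U" using F A by blast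
  qed
qed

section \<open>Orbits and their representatives\<close>

locale tree_action = rtree T for T :: "('v, 'a) rgraph" +
  fixes G :: "('v \<Rightarrow> 'v) set" and vs :: "'v set \<Rightarrow> 'v" and gw :: "'v \<Rightarrow> 'v \<Rightarrow> 'v"
  assumes subgroup_G: "subgroup G (AutT T)"
    and vs: "v \<in> verts (quotient_rgraph T G) \<Longrightarrow> vs v \<in> verts T \<and> vert_orbit G (vs v) = v"
    and gw: "w \<in> verts T \<Longrightarrow> gw w \<in> G \<and> gw w w \<in> vs ` verts (quotient_rgraph T G)"
begin

lemma G_aut: "g \<in> G \<Longrightarrow> g \<in> tree_aut T"
  using subgroup_G unfolding subgroup_AutT_iff by blast

lemma G_compose: "g \<in> G \<Longrightarrow> h \<in> G \<Longrightarrow> compose V g h \<in> G"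
  using subgroup_G unfolding subgroup_AutT_iff by blast

lemma G_tinv: "g \<in> G \<Longrightarrow> tinv g \<in> G"
  using subgroup_G unfolding subgroup_AutT_iff by blast

lemma vert_orbit_translate:
  assumes "g \<in> G" "v \<in> V" shows "vert_orbit G (g v) = vert_orbit G v"
proof
  have "h (g v) = compose V h g v" for h using assms(2) by (simp add: compose_eq)
  then show "vert_orbit G (g v) \<subseteq> vert_orbit G v"
    unfolding vert_orbit_def using G_compose[OF _ assms(1)] by blast
  have "h v = compose V h (tinv g) (g v)" for h
    using assms tinv_left[OF tree_aut_Bij] G_aut tree_aut_mem by (simp add: compose_eq)
  then show "vert_orbit G v \<subseteq> vert_orbit G (g v)"
    unfolding vert_orbit_def using G_compose[OF _ G_tinv[OF assms(1)]] by blast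
qed

lemma arc_orbit_translate:
  assumes "g \<in> G" "a \<in> arcs T" shows "arc_orbit T G (arc_act T g a) = arc_orbit T G a"
proof
  have "arc_act T h (arc_act T g a) = arc_act T (compose V h g) a" if "h \<in> G" for h
    using assms that G_aut by (simp add: arc_act_compose)
  then show "arc_orbit T G (arc_act T g a) \<subseteq> arc_orbit T G a"
    unfolding arc_orbit_def using G_compose[OF _ assms(1)] by fastforce
  have "arc_act T h a = arc_act T (compose V h (tinv g)) (arc_act T g a)" if "h \<in> G" for h
    using assms that G_aut G_tinv by (simp add: arc_act_compose arc_act arc_act_tinv)
  then show "arc_orbit T G a \<subseteq> arc_orbit T G (arc_act T g a)"
    unfolding arc_orbit_def using G_compose[OF _ G_tinv[OF assms(1)]] by fastforce
qed

lemma orbit_in_quotient: "v \<in> V \<Longrightarrow> vert_orbit G v \<in> verts (quotient_rgraph T G)"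
  unfolding quotient_rgraph_def by simp

lemma vs_vert_orbit:
  assumes "v \<in> V"
  shows "vs (vert_orbit G v) \<in> V" "vert_orbit G (vs (vert_orbit G v)) = vert_orbit G v"
  using vs[OF orbit_in_quotient[OF assms]] by auto

text \<open>\<open>gw v v\<close> is assumed to be some representative; it lies in the orbit of
  \<open>v\<close>, and a representative determines its orbit.\<close>

lemma gw_root:
  assumes "v \<in> V" shows "gw v v = vs (vert_orbit G v)"
proof -
  obtain w where w: "w \<in> verts (quotient_rgraph T G)" "gw v v = vs w" using gw[OF assms] by blast
  then have "w = vert_orbit G (gw v v)" using vs by simp
  then show ?thesis using vert_orbit_translate[of "gw v" v] gw[OF assms] assms w by simp
qed

lemma orig_arc_orbit:
  assumes "b \<in> arcs T" shows "orig T ` arc_orbit T G b = vert_orbit G (orig T b)"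
proof -
  have "orig T (arc_act T g b) = g (orig T b)" if "g \<in> G" for g
    using assms that G_aut by (simp add: arc_act)
  then show ?thesis unfolding arc_orbit_def vert_orbit_def by force
qed

text \<open>Each arc at the representative lies in an arc orbit whose origin is the orbit of
  \<open>v\<close>, so the colour sets cover all arcs there.\<close>

lemma vert_colours_assoc_diagram:
  assumes "v \<in> V"
  shows "vert_colours (assoc_diagram T G vs) (vert_orbit G v) = out_arcs T (vs (vert_orbit G v))"
proof -
  define r where "r = vs (vert_orbit G v)"
  have r: "vert_orbit G r = vert_orbit G v" using vs_vert_orbit assms unfolding r_def by simp
  have arcsD: "arc_orbit T G b \<in> arc_orbit T G ` arcs T \<and> orig T ` arc_orbit T G b = vert_orbit G v"
    if "b \<in> out_arcs T r" for b
    using that orig_arc_orbit r unfolding out_arcs_def by auto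
  show ?thesis
    unfolding vert_colours_def assoc_diagram_def Let_def quotient_rgraph_def r_def[symmetric]
    using arcsD by (auto simp: out_arcs_def r_def)
qed

text \<open>The automorphism \<open>transport v g\<close> extends the local action of \<open>g\<close> at \<open>v\<close>, read at the orbit
  representative \<open>vs (vert_orbit G v)\<close>, to the whole tree.\<close>

definition transport :: "'v \<Rightarrow> ('v \<Rightarrow> 'v) \<Rightarrow> 'v \<Rightarrow> 'v" where
  "transport v g = compose V (gw (g v)) (compose V g (tinv (gw v)))"

lemma gw_aut: "v \<in> V \<Longrightarrow> gw v \<in> tree_aut T"
  using gw G_aut by blast

lemma transport_aut:
  assumes "g \<in> tree_aut T" "v \<in> V" shows "transport v g \<in> tree_aut T"
  unfolding transport_def using assms gw_aut tree_aut_mem tree_aut_compose tree_aut_tinv by simp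

lemma transport_gw:
  assumes "g \<in> tree_aut T" "v \<in> V" "w \<in> V"
  shows "transport v g (gw v w) = gw (g v) (g w)"
  using assms gw_aut[OF assms(2)] tree_aut_mem tinv_left[OF tree_aut_Bij]
  unfolding transport_def by (simp add: compose_eq)

text \<open>As \<open>v\<close> and \<open>g v\<close> share an orbit, \<open>gw v\<close> and
  \<open>gw (g v)\<close> send them to the same representative.\<close>

lemma transport_root:
  assumes "g \<in> tree_aut T" "v \<in> V" "vert_orbit G (g v) = vert_orbit G v"
  shows "transport v g (vs (vert_orbit G v)) = vs (vert_orbit G v)"
  using transport_gw[OF assms(1,2,2)] gw_root[OF assms(2)] gw_root[OF tree_aut_mem[OF assms(1,2)]]
    assms(3) by simp

text \<open>Surjectivity of the labelling at \<open>v\<close>: arcs are pulled back by the inverse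
  of \<open>gw v\<close>.\<close>

lemma out_arcs_root_preimage:
  assumes v: "v \<in> V" and x: "x \<in> out_arcs T (vs (vert_orbit G v))"
  obtains b where "b \<in> out_arcs T v" "x = arc_act T (gw v) b"
proof
  have "tinv (gw v) (vs (vert_orbit G v)) = v"
    using tinv_left[OF tree_aut_Bij[OF gw_aut[OF v]] v] gw_root[OF v] by simp
  then show "arc_act T (tinv (gw v)) x \<in> out_arcs T v"
    using arc_act_out_arcs[OF tree_aut_tinv[OF gw_aut[OF v]] x] by simp
  show "x = arc_act T (gw v) (arc_act T (tinv (gw v)) x)"
    using x arc_act_tinv[OF gw_aut[OF v]] unfolding out_arcs_def by simp
qed

lemma transport_arc:
  assumes g: "g \<in> tree_aut T" and v: "v \<in> V" and b: "b \<in> arcs T"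
  shows "arc_act T (transport v g) (arc_act T (gw v) b) = arc_act T (gw (g v)) (arc_act T g b)"
proof -
  have gv: "g v \<in> V" using tree_aut_mem[OF g v] .
  show ?thesis
    using arc_verts[OF b] b g v gv
    by (intro arc_eqI) (simp_all add: arc_act gw_aut transport_aut transport_gw)
qed

section \<open>Local actions and local groups\<close>

text \<open>Labels are given by the action of \<open>gw v\<close> at \<open>v\<close> and of
  \<open>gw (g v)\<close> at \<open>g v\<close>, so passing through them composes \<open>g\<close>
  exactly as \<open>transport\<close> does.\<close>

lemma local_action_eq:
  assumes g: "g \<in> tree_aut T" and v: "v \<in> V"
  shows "local_action (assoc_diagram T G vs) (assoc_delta_tree T G gw) v g =
    restrict (arc_act T (transport v g)) (out_arcs T (vs (vert_orbit G v)))"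
proof
  fix x
  let ?X = "out_arcs T (vs (vert_orbit G v))"
  let ?lab = "label (assoc_delta_tree T G gw)"
  have lab: "?lab b = arc_act T (gw w) b" if "b \<in> out_arcs T w" for b w
    using that unfolding assoc_delta_tree_def out_arcs_def by simp
  \<comment> \<open>Injectivity makes \<open>inv_into\<close> the true inverse of the labelling at
    \<open>v\<close>.\<close>
  have inj: "inj_on ?lab (out_arcs T v)"
  proof (rule inj_onI)
    fix b c assume bc: "b \<in> out_arcs T v" "c \<in> out_arcs T v" and "?lab b = ?lab c"
    then have "arc_act T (gw v) b = arc_act T (gw v) c" by (simp add: lab)
    moreover have "b \<in> arcs T" "c \<in> arcs T" using bc unfolding out_arcs_def by auto
    ultimately show "b = c" using arc_act_tinv(1)[OF gw_aut[OF v]] by metis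
  qed
  have colours: "vert_colours (assoc_diagram T G vs) (vproj (assoc_delta_tree T G gw) v) = ?X"
    "dtree (assoc_delta_tree T G gw) = T"
    using vert_colours_assoc_diagram[OF v] by (simp_all add: assoc_delta_tree_def)
  show "local_action (assoc_diagram T G vs) (assoc_delta_tree T G gw) v g x =
    restrict (arc_act T (transport v g)) ?X x"
  proof (cases "x \<in> ?X")
    case True
    then obtain b where b: "b \<in> out_arcs T v" "x = arc_act T (gw v) b"
      using out_arcs_root_preimage[OF v] by blast
    then have "inv_into (out_arcs T v) ?lab x = b"
      using inv_into_f_eq[OF inj b(1)] lab by simp
    moreover have "?lab (arc_act T g b) = arc_act T (gw (g v)) (arc_act T g b)"
      using lab arc_act_out_arcs[OF g b(1)] by simp
    moreover have "b \<in> arcs T" using b unfolding out_arcs_def by simp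
    ultimately show ?thesis
      using True transport_arc[OF g v] b(2) unfolding local_action_def colours by simp
  next
    case False
    then show ?thesis unfolding local_action_def colours by simp
  qed
qed

text \<open>Since \<open>transport v g\<close> fixes the representative, it permutes the arcs there,
  and \<open>closure_of_perm_topology\<close> turns membership in the closure into matching on
  finite sets.\<close>

lemma local_action_mem_iff:
  assumes g: "g \<in> tree_aut T" and v: "v \<in> V" and orbit: "vert_orbit G (g v) = vert_orbit G v"
  shows "local_action (assoc_diagram T G vs) (assoc_delta_tree T G gw) v g
      \<in> local_grp (assoc_diagram T G vs) (vert_orbit G v) \<longleftrightarrow>
    (\<forall>F. finite F \<longrightarrow> F \<subseteq> out_arcs T (vs (vert_orbit G v)) \<longrightarrow>
      (\<exists>s\<in>pointwise_stab G {vs (vert_orbit G v)}.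
        \<forall>x\<in>F. arc_act T s x = arc_act T (transport v g) x))"
proof -
  define r where "r = vs (vert_orbit G v)"
  define A where "A = {restrict (arc_act T s) (out_arcs T r) | s. s \<in> pointwise_stab G {r}}"
  have r: "r \<in> V" using vs_vert_orbit[OF v] unfolding r_def by simp
  have "A \<subseteq> Bij (out_arcs T r)"
    unfolding A_def pointwise_stab_def using out_arcs_stab_Bij[OF _ r] G_aut by auto
  then have "restrict (arc_act T (transport v g)) (out_arcs T r)
      \<in> perm_topology (out_arcs T r) closure_of A \<longleftrightarrow>
    (\<forall>F. finite F \<longrightarrow> F \<subseteq> out_arcs T r \<longrightarrow>
      (\<exists>h\<in>A. \<forall>x\<in>F. h x = restrict (arc_act T (transport v g)) (out_arcs T r) x))"
    using closure_of_perm_topology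
      out_arcs_stab_Bij[OF transport_aut[OF g v] r] transport_root[OF g v orbit]
    unfolding r_def[symmetric] by blast
  also have "\<dots> \<longleftrightarrow> (\<forall>F. finite F \<longrightarrow> F \<subseteq> out_arcs T r \<longrightarrow>
      (\<exists>s\<in>pointwise_stab G {r}. \<forall>x\<in>F. arc_act T s x = arc_act T (transport v g) x))"
  proof -
    have "(\<exists>h\<in>A. \<forall>x\<in>F. h x = restrict (arc_act T (transport v g)) (out_arcs T r) x) \<longleftrightarrow>
      (\<exists>s\<in>pointwise_stab G {r}. \<forall>x\<in>F. arc_act T s x = arc_act T (transport v g) x)"
      if "F \<subseteq> out_arcs T r" for F
    proof -
      have "(\<exists>h\<in>A. P h) \<longleftrightarrow>
          (\<exists>s\<in>pointwise_stab G {r}. P (restrict (arc_act T s) (out_arcs T r)))" for P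
        unfolding A_def by blast
      moreover have "(\<forall>x\<in>F. restrict k (out_arcs T r) x = restrict l (out_arcs T r) x) \<longleftrightarrow>
          (\<forall>x\<in>F. k x = l x)" for k l :: "'a \<Rightarrow> 'a"
        using that by auto
      ultimately show ?thesis by simp
    qed
    then show ?thesis by auto
  qed
  finally show ?thesis
    unfolding local_action_eq[OF g v] unfolding assoc_diagram_def A_def r_def by (simp add: Let_def)
qed

lemma universal_group_mem_iff:
  "g \<in> universal_group (assoc_diagram T G vs) (assoc_delta_tree T G gw) \<longleftrightarrow>
    g \<in> tree_aut T \<and> (\<forall>v\<in>V. vert_orbit G (g v) = vert_orbit G v) \<and>
    (\<forall>a\<in>arcs T. arc_orbit T G (arc_act T g a) = arc_orbit T G a) \<and>
    (\<forall>v\<in>V. local_action (assoc_diagram T G vs) (assoc_delta_tree T G gw) v g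
      \<in> local_grp (assoc_diagram T G vs) (vert_orbit G v))"
  unfolding universal_group_def by (simp add: assoc_delta_tree_def)

section \<open>The two inclusions\<close>

lemma universal_group_subset:
  "universal_group (assoc_diagram T G vs) (assoc_delta_tree T G gw) \<subseteq> local_closure G"
proof
  fix g assume "g \<in> universal_group (assoc_diagram T G vs) (assoc_delta_tree T G gw)"
  then have g: "g \<in> tree_aut T" and orbit: "\<And>v. v \<in> V \<Longrightarrow> vert_orbit G (g v) = vert_orbit G v"
    and act: "\<And>v. v \<in> V \<Longrightarrow> local_action (assoc_diagram T G vs) (assoc_delta_tree T G gw) v g
      \<in> local_grp (assoc_diagram T G vs) (vert_orbit G v)"
    unfolding universal_group_mem_iff by auto
  show "g \<in> local_closure G"
    unfolding local_closure_def
  proof (intro CollectI conjI ballI allI impI)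
    show "g \<in> tree_aut T" by fact
    fix v X assume v: "v \<in> V" and X: "finite X" "\<forall>w\<in>X. w = v \<or> adj T v w"
    define r where "r = vs (vert_orbit G v)"
    \<comment> \<open>\<open>B\<close> turns neighbours in \<open>X\<close> into arcs at
      \<open>v\<close>; it is finite because such an arc is determined by its end.\<close>
    define B where "B = {b \<in> out_arcs T v. term_of T b \<in> X}"
    have gv: "g v \<in> V" using tree_aut_mem[OF g v] .
    have "inj_on (term_of T) B"
      by (rule inj_onI) (auto simp: B_def out_arcs_def intro: arc_eqI)
    moreover have "term_of T ` B \<subseteq> X" unfolding B_def by auto
    ultimately have "finite B" using X(1) by (rule inj_on_finite)
    moreover have "arc_act T (gw v) ` B \<subseteq> out_arcs T r"
      using arc_act_out_arcs[OF gw_aut[OF v], of _ v] gw_root[OF v] unfolding B_def r_def by auto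
    ultimately have "\<exists>s\<in>pointwise_stab G {r}.
        \<forall>x\<in>arc_act T (gw v) ` B. arc_act T s x = arc_act T (transport v g) x"
      using act[OF v] finite_imageI[of B "arc_act T (gw v)"]
      unfolding local_action_mem_iff[OF g v orbit[OF v]] r_def[symmetric] by metis
    then obtain s where s: "s \<in> G" "s r = r"
      "\<And>b. b \<in> B \<Longrightarrow> arc_act T s (arc_act T (gw v) b) = arc_act T (transport v g) (arc_act T (gw v) b)"
      unfolding pointwise_stab_def by blast
    \<comment> \<open>At \<open>v\<close> both sides are the representative, which \<open>s\<close>
      fixes; at a neighbour the ends of the matched arcs are compared.\<close>
    have eq: "s (gw v w) = gw (g v) (g w)" if w: "w \<in> X" for w
    proof (cases "w = v")
      case True
      then show ?thesis using s(2) gw_root[OF v] gw_root[OF gv] orbit[OF v] unfolding r_def by simp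
    next
      case False
      then obtain b where b: "b \<in> B" "term_of T b = w" "b \<in> arcs T"
        using X(2) w unfolding B_def adj_def out_arcs_def by auto
      have "arc_act T s (arc_act T (gw v) b) = arc_act T (gw (g v)) (arc_act T g b)"
        using s(3)[OF b(1)] transport_arc[OF g v b(3)] by simp
      then show ?thesis
        using arc_act b(2,3) gw_aut[OF v] gw_aut[OF gv] g G_aut[OF s(1)] by metis
    qed
    \<comment> \<open>Undoing \<open>gw\<close> at \<open>v\<close> and at \<open>g v\<close> turns
      \<open>s\<close> into an element of \<open>G\<close> that matches \<open>g\<close> on
      \<open>X\<close>.\<close>
    define h where "h = compose V (tinv (gw (g v))) (compose V s (gw v))"
    have "g w = h w" if w: "w \<in> X" for w
    proof -
      have wV: "w \<in> V" using X(2) w v by (auto dest: adj_verts)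
      then have "h w = tinv (gw (g v)) (gw (g v) (g w))"
        unfolding h_def using eq[OF w] by (simp add: compose_eq)
      then show ?thesis
        using tinv_left[OF tree_aut_Bij[OF gw_aut[OF gv]] tree_aut_mem[OF g wV]] by simp
    qed
    moreover have "h \<in> G" unfolding h_def using G_compose G_tinv gw v gv s(1) by simp
    ultimately show "\<exists>h\<in>G. \<forall>w\<in>X. g w = h w" by blast
  qed
qed

text \<open>If \<open>h\<close> in \<open>G\<close> matches \<open>g\<close> near \<open>v\<close>,
  then \<open>transport v h\<close> is a product of elements of \<open>G\<close>; it supplies the
  required approximation at the representative.\<close>

lemma local_closure_subset:
  "local_closure G \<subseteq> universal_group (assoc_diagram T G vs) (assoc_delta_tree T G gw)"
proof
  fix g assume gC: "g \<in> local_closure G"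
  note g = local_closure_aut[OF gC]
  have orbit: "vert_orbit G (g v) = vert_orbit G v" if v: "v \<in> V" for v
  proof -
    obtain h where "h \<in> G" "\<And>w. w \<in> {v} \<Longrightarrow> g w = h w"
      using local_closureD[OF gC v, of "{v}"] by blast
    then show ?thesis using vert_orbit_translate v by simp
  qed
  moreover have "arc_orbit T G (arc_act T g a) = arc_orbit T G a" if a: "a \<in> arcs T" for a
  proof -
    \<comment> \<open>Both ends of \<open>a\<close> lie in the ball around its origin, so one
      element of \<open>G\<close> matches \<open>g\<close> on them and hence on
      \<open>a\<close>.\<close>
    have "adj T (orig T a) (term_of T a)" using a unfolding adj_def by blast
    then obtain h where h: "h \<in> G" "\<And>w. w \<in> {orig T a, term_of T a} \<Longrightarrow> g w = h w"
      using local_closureD[OF gC arc_verts(1)[OF a], of "{orig T a, term_of T a}"] by blast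
    then have "arc_act T g a = arc_act T h a"
      using a g G_aut[OF h(1)] by (intro arc_eqI) (simp_all add: arc_act)
    then show ?thesis using arc_orbit_translate h(1) a by simp
  qed
  moreover have "local_action (assoc_diagram T G vs) (assoc_delta_tree T G gw) v g
      \<in> local_grp (assoc_diagram T G vs) (vert_orbit G v)" if v: "v \<in> V" for v
    unfolding local_action_mem_iff[OF g v orbit[OF v]]
  proof (intro allI impI)
    fix F assume F: "finite F" "F \<subseteq> out_arcs T (vs (vert_orbit G v))"
    have gv: "g v \<in> V" using tree_aut_mem[OF g v] .
    \<comment> \<open>\<open>B\<close> is \<open>F\<close> read at \<open>v\<close>. Including
      \<open>v\<close> in \<open>X\<close> forces \<open>h v = g v\<close>, so both transports end
      with the same \<open>gw (g v)\<close>.\<close>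
    define B where "B = arc_act T (tinv (gw v)) ` F"
    define X where "X = insert v (term_of T ` B)"
    have B: "b \<in> out_arcs T v \<and> x = arc_act T (gw v) b"
      if "x \<in> F" "b = arc_act T (tinv (gw v)) x" for x b
    proof -
      have "x \<in> out_arcs T (vs (vert_orbit G v))" using F(2) that(1) by (rule subsetD)
      then obtain c where c: "c \<in> out_arcs T v" "x = arc_act T (gw v) c"
        using out_arcs_root_preimage[OF v] by metis
      then have "b = c"
        using arc_act_tinv(1)[OF gw_aut[OF v]] that(2) unfolding out_arcs_def by simp
      then show ?thesis using c by simp
    qed
    have "w = v \<or> adj T v w" if "w \<in> X" for w
      using that B unfolding X_def B_def adj_def out_arcs_def by auto
    moreover have "finite X" unfolding X_def B_def using F(1) by simp
    ultimately obtain h where h: "h \<in> G" "\<And>w. w \<in> X \<Longrightarrow> g w = h w"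
      using local_closureD[OF gC v] by metis
    note haut = G_aut[OF h(1)]
    have hv: "h v = g v" using h(2) unfolding X_def by simp
    have "transport v h \<in> G"
      unfolding transport_def hv using G_compose G_tinv gw v gv h(1) by simp
    moreover have "transport v h (vs (vert_orbit G v)) = vs (vert_orbit G v)"
      using transport_root[OF haut v] orbit[OF v] hv by simp
    moreover have "arc_act T (transport v h) x = arc_act T (transport v g) x" if x: "x \<in> F" for x
    proof -
      define b where "b = arc_act T (tinv (gw v)) x"
      have b: "b \<in> out_arcs T v" "x = arc_act T (gw v) b" using B[OF x b_def] by auto
      then have bT: "b \<in> arcs T" "orig T b = v" unfolding out_arcs_def by auto
      have "term_of T b \<in> X" unfolding X_def B_def b_def using x by blast
      then have "arc_act T h b = arc_act T g b"
        using bT h(2) hv g haut by (intro arc_eqI) (simp_all add: arc_act)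
      then show ?thesis
        unfolding b(2) transport_arc[OF haut v bT(1)] transport_arc[OF g v bT(1)] hv by simp
    qed
    ultimately show "\<exists>s\<in>pointwise_stab G {vs (vert_orbit G v)}.
        \<forall>x\<in>F. arc_act T s x = arc_act T (transport v g) x"
      unfolding pointwise_stab_def by blast
  qed
  ultimately show "g \<in> universal_group (assoc_diagram T G vs) (assoc_delta_tree T G gw)"
    unfolding universal_group_mem_iff using g by blast
qed

end

theorem theorem3p10:
  fixes T :: "('v, 'a) rgraph"
    and G :: "('v \<Rightarrow> 'v) set"
    and vs :: "'v set \<Rightarrow> 'v"
    and gw :: "'v \<Rightarrow> 'v \<Rightarrow> 'v"
  assumes "is_tree T"
    and "subgroup G (AutT T)"
    and "\<And>v. v \<in> verts (quotient_rgraph T G) \<Longrightarrow> vs v \<in> verts T \<and> vert_orbit G (vs v) = v"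
    and "\<And>w. w \<in> verts T \<Longrightarrow> gw w \<in> G \<and> gw w w \<in> vs ` verts (quotient_rgraph T G)"
  shows "is_P_closure T G (universal_group (assoc_diagram T G vs) (assoc_delta_tree T G gw))"
proof -
  interpret tree_action T G vs gw
    by (intro tree_action.intro rtree.intro tree_action_axioms.intro assms)
  have "universal_group (assoc_diagram T G vs) (assoc_delta_tree T G gw) = local_closure G"
    using universal_group_subset local_closure_subset by (rule equalityI)
  then show ?thesis using is_P_closure_local_closure assms(2) by simp
qed

end
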